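(* Fix $\sigma>0$, $\lambda>0$, $N\ge1$ and $\beta>0$. Assume that the noise distribution $\Psi$ satisfies [Shape] and [Decay]. Then, in dimension $d=2$, the optimally tuned worst-case risk of median filtering over $\mathrm{CPLIP}=\mathrm{CPLIP}(\lambda,\beta,N)$ satisfies $$\inf_{h>0}\mathcal{R}_n(M_h;\mathrm{CPLIP})\asymp n^{-2/3},\qquad n\to\infty .$$
   Context: Model ($d=2$): let $\mathbb{I}_n=\{1,\dots,n\}$. One observes $Y_n(\mathbf{i})=f(\mathbf{i}/n)+\sigma Z_n(\mathbf{i})$, $\mathbf{i}\in\mathbb{I}_n^2$, where $f:[0,1]^2\to[0,1]$ is unknown, $\sigma>0$ is a fixed noise level and $(Z_n(\mathbf{i}))_{\mathbf{i}\in\mathbb{I}_n^2}$ is white noise, i.e. i.i.d. random variables with distribution $\Psi$. Conditions on $\Psi$. [Shape]: $\Psi$ has a density $\psi$ with respect to Lebesgue measure on $\mathbb{R}$, with $\psi$ unimodal, continuous and symmetric about $0$. [Decay]: $\zeta(\Psi):=\sup\{s>0:\psi(x)(|x|+1)^s\text{ is bounded in }x\}>1$. Median filter: for $h>0$ let $\mathcal{W}[n,h](\mathbf{i})=\{\mathbf{j}\in\mathbb{I}_n^2:\|\mathbf{j}-\mathbf{i}\|\le nh\}$ (Euclidean norm) and $M_h[Y_n](\mathbf{i})=\mathrm{Median}\{Y_n(\mathbf{j}):\mathbf{j}\in\mathcal{W}[n,h](\mathbf{i})\}$ (empirical median). Risk: for an estimator $T$, $\mathcal{R}_n(T;f)=\frac1{n^2}\sum_{\mathbf{i}\in\mathbb{I}_n^2}\mathbb{E}[(T[Y_n](\mathbf{i})-f(\mathbf{i}/n))^2]$,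 and for a class $\mathcal{F}$ of functions, $\mathcal{R}_n(T;\mathcal{F})=\sup_{f\in\mathcal{F}}\mathcal{R}_n(T;f)$. Function class: the local Lipschitz constant of $f$ at $x$ is $\mathrm{Lip}_x(f)=\limsup_{\varepsilon\to0}\sup_{|y-x|\le\varepsilon,\,y\ne x}\frac{|f(y)-f(x)|}{|y-x|}$. $\Gamma(\lambda)$ is the class of rectifiable curves in $[0,1]^2$ with length at most $\lambda$; $\mathcal{C}(N,\lambda)$ is the collection of complexes (finite collections of curves) composed of at most $N$ curves from $\Gamma(\lambda)$. $\mathrm{CPLIP}(\lambda,\beta,N)$ is the collection of functions $f:[0,1]^2\to[0,1]$ having local Lipschitz constant bounded by $\beta$ at every point of the complement of (the union of the curves of) some complex in $\mathcal{C}(N,\lambda)$, which may depend on $f$. $a_n\asymp b_n$ means that the ratio $a_n/b_n$ is bounded away from $0$ and $\infty$ as $n$ becomes large (constants may depend on $\sigma,\lambda,\beta,N,\Psi$). *)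

theory Defs
  imports "HOL-Probability.Probability"
begin

section \<open>Curves, complexes and the class CPLIP\<close>

text \<open>The plane is \<^typ>\<open>real \<times> real\<close>, whose library norm is the Euclidean one. A function on the
  unit square is a total function of which only the values on the square matter. The
  length bound is written \<open>L\<close>.\<close>

definition unit_square :: "(real \<times> real) set" where
  "unit_square = {0..1} \<times> {0..1}"

definition curve_length :: "(real \<Rightarrow> real \<times> real) \<Rightarrow> ennreal" where
  "curve_length g =
     (SUP (t, m) \<in> {(t :: nat \<Rightarrow> real, m). mono_on {..m} t \<and> t ` {..m} \<subseteq> {0..1}}.
        \<Sum>k<m. ennreal (dist (g (t (Suc k))) (g (t k))))"

definition rect_curves :: "real \<Rightarrow> (real \<Rightarrow> real \<times> real) set" where
  "rect_curves L =
     {g. path g \<and> path_image g \<subseteq> unit_square \<and> curve_length g \<le> ennreal L}"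

definition complexes :: "nat \<Rightarrow> real \<Rightarrow> (real \<Rightarrow> real \<times> real) set set" where
  "complexes N L = {K. K \<subseteq> rect_curves L \<and> finite K \<and> card K \<le> N}"

definition local_Lip :: "(real \<times> real \<Rightarrow> real) \<Rightarrow> real \<times> real \<Rightarrow> ereal" where
  "local_Lip f x =
     Limsup (at_right (0 :: real))
       (\<lambda>\<epsilon>. SUP y \<in> {y \<in> unit_square. norm (y - x) \<le> \<epsilon> \<and> y \<noteq> x}.
               ereal (\<bar>f y - f x\<bar> / norm (y - x)))"

definition CPLIP :: "real \<Rightarrow> real \<Rightarrow> nat \<Rightarrow> (real \<times> real \<Rightarrow> real) set" where
  "CPLIP L \<beta> N =
     {f. f ` unit_square \<subseteq> {0..1} \<and>
         (\<exists>K \<in> complexes N L.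
            \<forall>x \<in> unit_square - (\<Union>g\<in>K. path_image g). local_Lip f x \<le> ereal \<beta>)}"

section \<open>Noise\<close>

definition unimodal :: "(real \<Rightarrow> real) \<Rightarrow> bool" where
  "unimodal \<psi> \<longleftrightarrow> (\<exists>m. mono_on {..m} \<psi> \<and> antimono_on {m..} \<psi>)"

definition shape_cond :: "real measure \<Rightarrow> (real \<Rightarrow> real) \<Rightarrow> bool" where
  "shape_cond \<Psi> \<psi> \<longleftrightarrow>
     (\<forall>x. 0 \<le> \<psi> x) \<and> \<Psi> = density lborel (\<lambda>x. ennreal (\<psi> x)) \<and>
     unimodal \<psi> \<and> continuous_on UNIV \<psi> \<and> (\<forall>x. \<psi> (- x) = \<psi> x)"

text \<open>The exponent is a function of the noise law, since a continuous density is unique. It is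
  extended real because it is infinite for, say, Gaussian noise.\<close>

definition decay_exponent :: "(real \<Rightarrow> real) \<Rightarrow> ereal" where
  "decay_exponent \<psi> =
     (SUP s \<in> {s. 0 < s \<and> bounded (range (\<lambda>x. \<psi> x * (\<bar>x\<bar> + 1) powr s))}. ereal s)"

definition grid :: "nat \<Rightarrow> (nat \<times> nat) set" where
  "grid n = {1..n} \<times> {1..n}"

definition white_noise ::
    "'a measure \<Rightarrow> real measure \<Rightarrow> nat \<Rightarrow> (nat \<times> nat \<Rightarrow> 'a \<Rightarrow> real) \<Rightarrow> bool" where
  "white_noise M \<Psi> n Z \<longleftrightarrow>
     prob_space.indep_vars M (\<lambda>_. borel) Z (grid n) \<and>
     (\<forall>i \<in> grid n. distr M borel (Z i) = \<Psi>)"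

section \<open>Observations, median filter and risk\<close>

definition grid_point :: "nat \<Rightarrow> nat \<times> nat \<Rightarrow> real \<times> real" where
  "grid_point n i = (real (fst i) / real n, real (snd i) / real n)"

definition observe ::
    "nat \<Rightarrow> real \<Rightarrow> (nat \<times> nat \<Rightarrow> 'a \<Rightarrow> real) \<Rightarrow> (real \<times> real \<Rightarrow> real) \<Rightarrow> 'a \<Rightarrow> nat \<times> nat \<Rightarrow> real" where
  "observe n \<sigma> Z f \<omega> i = f (grid_point n i) + \<sigma> * Z i \<omega>"

definition window :: "nat \<Rightarrow> real \<Rightarrow> nat \<times> nat \<Rightarrow> (nat \<times> nat) set" where
  "window n h i =
     {j \<in> grid n.
        norm (real (fst j) - real (fst i), real (snd j) - real (snd i)) \<le> real n * h}"

text \<open>The median of a sample of even size is the midpoint of its two central order statistics;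
  for odd size the two indices below coincide.\<close>

definition sample_median :: "real multiset \<Rightarrow> real" where
  "sample_median A =
     (let xs = sorted_list_of_multiset A; m = size A
      in (xs ! ((m - 1) div 2) + xs ! (m div 2)) / 2)"

definition median_filter ::
    "nat \<Rightarrow> real \<Rightarrow> (nat \<times> nat \<Rightarrow> real) \<Rightarrow> nat \<times> nat \<Rightarrow> real" where
  "median_filter n h Y i = sample_median (image_mset Y (mset_set (window n h i)))"

text \<open>Risks are extended nonnegative reals: the noise need not have a second moment, so the
  expected squared error can be infinite (e.g. when every window is a single pixel), where the
  Bochner integral would silently return 0.\<close>

definition risk ::
    "'a measure \<Rightarrow> nat \<Rightarrow> real \<Rightarrow> (nat \<times> nat \<Rightarrow> 'a \<Rightarrow> real) \<Rightarrow>
     ((nat \<times> nat \<Rightarrow> real) \<Rightarrow> nat \<times> nat \<Rightarrow> real) \<Rightarrow> (real \<times> real \<Rightarrow> real) \<Rightarrow> ennreal" where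
  "risk M n \<sigma> Z T f =
     ennreal (1 / (real n)\<^sup>2) *
     (\<Sum>i \<in> grid n.
        \<integral>\<^sup>+ \<omega>. ennreal ((T (observe n \<sigma> Z f \<omega>) i - f (grid_point n i))\<^sup>2) \<partial>M)"

definition class_risk ::
    "'a measure \<Rightarrow> nat \<Rightarrow> real \<Rightarrow> (nat \<times> nat \<Rightarrow> 'a \<Rightarrow> real) \<Rightarrow>
     ((nat \<times> nat \<Rightarrow> real) \<Rightarrow> nat \<times> nat \<Rightarrow> real) \<Rightarrow> (real \<times> real \<Rightarrow> real) set \<Rightarrow> ennreal" where
  "class_risk M n \<sigma> Z T F = (SUP f \<in> F. risk M n \<sigma> Z T f)"

text \<open>The ratio is bounded away from 0 and infinity for all large \<open>n\<close>; the upper bound is real,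
  so \<open>a n\<close> is in particular finite for large \<open>n\<close> when \<open>b n\<close> is.\<close>

definition same_order :: "(nat \<Rightarrow> ennreal) \<Rightarrow> (nat \<Rightarrow> ennreal) \<Rightarrow> bool" where
  "same_order a b \<longleftrightarrow>
     (\<exists>c C :: real. 0 < c \<and>
        (\<forall>\<^sub>F n in sequentially. ennreal c \<le> a n / b n \<and> a n / b n \<le> ennreal C))"

end

theory Submission
  imports Defs
begin

text \<open>
  With bandwidth \<open>h\<close> a window holds about \<open>m = (n h)\<^sup>2\<close> pixels, and the squared error at a pixel has
  three sources.

  \<^item> The spread of the median of \<open>m\<close> noise variables contributes order \<open>1 / m\<close>
    (lemma \<open>median_mse_upper\<close>).
  \<^item> Away from the curves \<open>f\<close> changes by at most \<open>O(h)\<close> on a window, so the bias contributes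
    \<open>O(h\<^sup>2)\<close>.
  \<^item> Within distance \<open>h\<close> of a curve the error is only bounded. A curve of length \<open>L\<close> is covered by
    \<open>L / h + 1\<close> discs of radius \<open>h\<close>, so there are \<open>O(n\<^sup>2 h)\<close> such pixels (lemma \<open>card_tube\<close>) and
    they contribute \<open>O(h)\<close> to the average.

  The total is \<open>O(h + 1 / (n h)\<^sup>2)\<close>, which is \<open>O(n powr (-2/3))\<close> for \<open>h = n powr (-2/3)\<close>.

  Both of the terms that decide the optimum are really there. If \<open>h < n powr (-2/3)\<close>, then already for
  \<open>f = 0\<close> the median of at most \<open>9 * n powr (2/3)\<close> noise variables has second moment at least of
  order \<open>n powr (-2/3)\<close> (lemma \<open>median_variance_lower\<close>). If \<open>h \<ge> n powr (-2/3)\<close>, let \<open>f\<close> be the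
  indicator of a triangle in the corner of the square whose width is a small multiple of
  \<open>min h 1\<close> and whose height is constant. Its boundary inside the square is a single short segment.
  Around each pixel of the triangle almost the whole window lies outside, so with probability
  bounded below the median is at most \<open>1 / 2\<close> although \<open>f = 1\<close> there
  (lemma \<open>median_bias_lower\<close>), and the triangle holds a fraction of order \<open>min h 1\<close> of all pixels.

  Medians enter only through counts: the median exceeds \<open>t\<close> as soon as more than half of the sample does,
  and only if at least half of it does. The upper bound on the noise therefore rests on a Chernoff
  bound for \<open>P (#{Z > t} \<ge> m / 2)\<close>, the lower bound on the fourth moment of a sum of signs.
\<close>
section \<open>Order statistics and the median\<close>

text \<open>For an upward closed property the elements that satisfy it form a final segment of a sorted list,
  so membership of the \<open>k\<close>-th element is a statement about the length of that segment.\<close>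

lemma sorted_nth_upward_closed_iff:
  fixes xs :: "'b::linorder list"
  assumes "sorted xs" and k: "k < length xs"
    and "mono P"
  shows "P (xs ! k) \<longleftrightarrow> length xs \<le> k + length (filter P xs)"
proof -
  have up: "P y" if "x \<le> y" "P x" for x y
    using monoD[OF \<open>mono P\<close> that(1)] that(2) by simp
  show ?thesis
  proof
  assume P: "P (xs ! k)"
  have "\<forall>x \<in> set (drop k xs). P x"
  proof
    fix x assume "x \<in> set (drop k xs)"
    then obtain i where "i < length xs - k" "x = xs ! (k + i)"
      by (auto simp: in_set_conv_nth)
    then show "P x" using up[OF _ P] sorted_nth_mono[OF assms(1), of k "k+i"] by auto
  qed
  then have "length (filter P (drop k xs)) = length xs - k" by simp
  moreover have "length (filter P xs) = length (filter P (take k xs)) + length (filter P (drop k xs))"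
    by (metis append_take_drop_id filter_append length_append)
  ultimately show "length xs \<le> k + length (filter P xs)" by linarith
next
  assume len: "length xs \<le> k + length (filter P xs)"
  show "P (xs ! k)"
  proof (rule ccontr)
    assume nP: "\<not> P (xs ! k)"
    have "\<forall>x \<in> set (take (Suc k) xs). \<not> P x"
    proof
      fix x assume "x \<in> set (take (Suc k) xs)"
      then obtain i where "i < Suc k" "x = xs ! i"
        by (auto simp: in_set_conv_nth)
      then show "\<not> P x" using up nP sorted_nth_mono[OF assms(1), of i k] k by auto
    qed
    then have "filter P (take (Suc k) xs) = []" by (auto simp: filter_empty_conv)
    moreover have "filter P xs = filter P (take (Suc k) xs) @ filter P (drop (Suc k) xs)"
      by (metis append_take_drop_id filter_append)
    moreover have "length (filter P (drop (Suc k) xs)) \<le> length xs - Suc k"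
      by (metis length_drop length_filter_le)
    ultimately have "length (filter P xs) \<le> length xs - Suc k" by simp
    then show False using len k by linarith
  qed
  qed
qed

text \<open>Both central order statistics lie on the same side of a threshold as any strict majority of the
  sample. Treating the two together covers even and odd sample sizes at once.\<close>

lemma sample_median_central_pair:
  assumes "A \<noteq> {#}"
  shows "\<exists>x y. sample_median A = (x + y) / 2 \<and>
    (\<forall>P. mono P \<longrightarrow> (size A < 2 * size (filter_mset P A) \<longrightarrow> P x \<and> P y) \<and>
                   (2 * size (filter_mset P A) < size A \<longrightarrow> \<not> P x \<and> \<not> P y))"
proof -
  define xs where "xs = sorted_list_of_multiset A"
  have sorted: "sorted xs" and A: "mset xs = A" unfolding xs_def by auto
  have len: "length xs = size A" and pos: "size A > 0"
    using A assms by (auto simp: nonempty_has_size)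
  have filt: "size (filter_mset P A) = length (filter P xs)" for P
    by (metis A mset_filter size_mset)
  define k l where "k = (size A - 1) div 2" and "l = size A div 2"
  have kl: "k < length xs" "l < length xs" "2 * k \<le> 2 * l" "2 * l \<le> size A" "size A \<le> 2 * k + 2"
    unfolding k_def l_def using len pos by auto
  have hi: "P (xs ! k) \<and> P (xs ! l)" if up: "mono P" and s: "size A < 2 * size (filter_mset P A)" for P
  proof -
    have "length xs \<le> k + length (filter P xs)" "length xs \<le> l + length (filter P xs)"
      using s len filt[of P] kl by linarith+
    then show ?thesis
      using sorted_nth_upward_closed_iff[OF sorted kl(1) up]
        sorted_nth_upward_closed_iff[OF sorted kl(2) up] by simp
  qed
  have lo: "\<not> P (xs ! k) \<and> \<not> P (xs ! l)"
    if up: "mono P" and s: "2 * size (filter_mset P A) < size A" for P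
  proof -
    have "\<not> length xs \<le> k + length (filter P xs)" "\<not> length xs \<le> l + length (filter P xs)"
      using s len filt[of P] kl by linarith+
    then show ?thesis
      using sorted_nth_upward_closed_iff[OF sorted kl(1) up]
        sorted_nth_upward_closed_iff[OF sorted kl(2) up] by simp
  qed
  have "sample_median A = (xs ! k + xs ! l) / 2"
    by (simp add: sample_median_def xs_def Let_def k_def l_def)
  then show ?thesis using hi lo by blast
qed

lemma finite_grid [simp]: "finite (grid n)"
  by (simp add: grid_def)

lemma card_grid: "card (grid n) = n * n"
  by (simp add: grid_def)

lemma window_subset_grid: "window n h i \<subseteq> grid n"
  by (auto simp: window_def)

lemma finite_window [simp]: "finite (window n h i)"
  using finite_subset[OF window_subset_grid] by simp

lemma size_filter_sample:
  assumes "finite W"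
  shows "size (filter_mset P (image_mset Y (mset_set W))) = card {j \<in> W. P (Y j)}"
  by (simp add: filter_mset_image_mset filter_mset_mset_set[OF assms])

lemma
  assumes W: "W = window n h i" "W \<noteq> {}"
  shows median_le: "2 * card {j \<in> W. Y j > t} < card W \<Longrightarrow> median_filter n h Y i \<le> t"
    and median_ge: "2 * card {j \<in> W. Y j < t} < card W \<Longrightarrow> median_filter n h Y i \<ge> t"
    and median_gt: "card W < 2 * card {j \<in> W. Y j > t} \<Longrightarrow> median_filter n h Y i > t"
    and median_lt: "card W < 2 * card {j \<in> W. Y j < t} \<Longrightarrow> median_filter n h Y i < t"
proof -
  let ?A = "image_mset Y (mset_set W)"
  have fin: "finite W" using W by simp
  have "?A \<noteq> {#}" using W fin by (simp add: mset_set_empty_iff)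
  from sample_median_central_pair[OF this] obtain x y where xy: "sample_median ?A = (x + y) / 2"
    and hi: "\<And>P. mono P \<Longrightarrow> size ?A < 2 * size (filter_mset P ?A) \<Longrightarrow> P x \<and> P y"
    and lo: "\<And>P. mono P \<Longrightarrow> 2 * size (filter_mset P ?A) < size ?A \<Longrightarrow> \<not> P x \<and> \<not> P y"
    by (elim exE conjE) metis
  have mono: "mono (\<lambda>v. v > t)" "mono (\<lambda>v. v \<ge> t)" by (auto intro!: monoI)
  have M: "median_filter n h Y i = (x + y) / 2" using xy W by (simp add: median_filter_def)
  have sz: "size ?A = card W" by simp
  have compl: "card {j \<in> W. Y j < t} + card {j \<in> W. Y j \<ge> t} = card W"
  proof -
    have "{j \<in> W. Y j < t} \<union> {j \<in> W. Y j \<ge> t} = W" by auto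
    moreover have "{j \<in> W. Y j < t} \<inter> {j \<in> W. Y j \<ge> t} = {}" by auto
    ultimately show ?thesis using card_Un_disjoint[of "{j \<in> W. Y j < t}" "{j \<in> W. Y j \<ge> t}"] fin by auto
  qed
  show "median_filter n h Y i \<le> t" if "2 * card {j \<in> W. Y j > t} < card W"
    using lo[OF mono(1)] that M by (simp add: size_filter_sample[OF fin])
  show "median_filter n h Y i > t" if "card W < 2 * card {j \<in> W. Y j > t}"
    using hi[OF mono(1)] that M by (simp add: size_filter_sample[OF fin])
  show "median_filter n h Y i \<ge> t" if "2 * card {j \<in> W. Y j < t} < card W"
    using hi[OF mono(2)] that M compl by (simp add: size_filter_sample[OF fin])
  show "median_filter n h Y i < t" if "card W < 2 * card {j \<in> W. Y j < t}"
    using lo[OF mono(2)] that M compl by (simp add: size_filter_sample[OF fin])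
qed

section \<open>Functions with bounded local Lipschitz constants\<close>

lemma local_Lip_ball:
  assumes "local_Lip f x \<le> ereal \<beta>" "\<beta> < \<beta>'"
  shows "\<exists>d>0. \<forall>y\<in>unit_square. norm (y - x) \<le> d \<longrightarrow> \<bar>f y - f x\<bar> \<le> \<beta>' * norm (y - x)"
proof -
  let ?G = "\<lambda>\<epsilon>. SUP y \<in> {y \<in> unit_square. norm (y - x) \<le> \<epsilon> \<and> y \<noteq> x}.
               ereal (\<bar>f y - f x\<bar> / norm (y - x))"
  have "ereal \<beta> < ereal \<beta>'" using assms(2) by simp
  then have "eventually (\<lambda>\<epsilon>. ?G \<epsilon> < ereal \<beta>') (at_right 0)"
    using assms(1) unfolding local_Lip_def Limsup_le_iff by blast
  then obtain b where b: "b > 0" "\<And>\<epsilon>. \<epsilon> > 0 \<Longrightarrow> \<epsilon> < b \<Longrightarrow> ?G \<epsilon> < ereal \<beta>'"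
    unfolding eventually_at_right_field by blast
  show ?thesis
  proof (intro exI[of _ "b/2"] conjI ballI impI)
    fix y assume y: "y \<in> unit_square" "norm (y - x) \<le> b/2"
    show "\<bar>f y - f x\<bar> \<le> \<beta>' * norm (y - x)"
    proof (cases "y = x")
      case False
      have "ereal (\<bar>f y - f x\<bar> / norm (y - x)) \<le> ?G (b/2)"
        by (rule SUP_upper) (use y False in auto)
      also have "\<dots> < ereal \<beta>'" using b(1) by (intro b(2)) auto
      finally show ?thesis using False by (simp add: divide_simps split: if_splits)
    qed simp
  qed (use b in auto)
qed

text \<open>The local constant at \<open>z\<close> only compares \<open>z\<close> itself with nearby points, and the radius of comparison
  depends on \<open>z\<close>. Bisection still works: a short interval containing the parameter \<open>x\<close> is
  split at \<open>x\<close>, and the estimate centred at \<open>x\<close> is used on both halves. The slack between \<open>\<beta>\<close> and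
  \<open>\<beta>'\<close> absorbs the limit superior.\<close>

lemma local_Lip_segment:
  assumes seg: "\<And>z. z \<in> closed_segment a b \<Longrightarrow> z \<in> unit_square \<and> local_Lip f z \<le> ereal \<beta>"
    and "\<beta> < \<beta>'"
  shows "\<bar>f b - f a\<bar> \<le> \<beta>' * dist a b"
proof -
  define \<phi> where "\<phi> t = a + t *\<^sub>R (b - a)" for t :: real
  have \<phi>_in: "\<phi> t \<in> closed_segment a b" if "0 \<le> t" "t \<le> 1" for t
    using that unfolding \<phi>_def in_segment by (auto intro!: exI[of _ t] simp: algebra_simps)
  have \<phi>_dist: "norm (\<phi> s - \<phi> t) = \<bar>s - t\<bar> * norm (b - a)" for s t
    by (simp add: \<phi>_def flip: scaleR_diff_left norm_scaleR)
  let ?P = "\<lambda>s t. 0 \<le> s \<and> t \<le> 1 \<longrightarrow> \<bar>f (\<phi> t) - f (\<phi> s)\<bar> \<le> \<beta>' * ((t - s) * norm (b - a))"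
  have "(0::real) \<le> 1" by simp
  then have "?P 0 1"
  proof (induction rule: Bolzano[where P = ?P])
    case (trans s t u)
    show ?case
    proof
      assume *: "0 \<le> s \<and> u \<le> 1"
      then have "\<bar>f (\<phi> t) - f (\<phi> s)\<bar> \<le> \<beta>' * ((t - s) * norm (b - a))"
        "\<bar>f (\<phi> u) - f (\<phi> t)\<bar> \<le> \<beta>' * ((u - t) * norm (b - a))" using trans by auto
      then have "\<bar>f (\<phi> u) - f (\<phi> s)\<bar>
          \<le> \<beta>' * ((t - s) * norm (b - a)) + \<beta>' * ((u - t) * norm (b - a))" by linarith
      then show "\<bar>f (\<phi> u) - f (\<phi> s)\<bar> \<le> \<beta>' * ((u - s) * norm (b - a))"
        by (simp add: algebra_simps)
    qed
  next
    case (local x)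
    obtain d where d: "d > 0"
      "\<And>y. y \<in> unit_square \<Longrightarrow> norm (y - \<phi> x) \<le> d \<Longrightarrow> \<bar>f y - f (\<phi> x)\<bar> \<le> \<beta>' * norm (y - \<phi> x)"
      using local_Lip_ball[of f "\<phi> x" \<beta> \<beta>'] seg[OF \<phi>_in[of x]] local assms(2) by blast
    show ?case
    proof (intro exI[of _ "d / (norm (b - a) + 1)"] conjI allI impI)
      show "0 < d / (norm (b - a) + 1)" using d by (simp add: add_nonneg_pos)
      fix s t assume st: "s \<le> x \<and> x \<le> t \<and> t - s < d / (norm (b - a) + 1)" and st01: "0 \<le> s \<and> t \<le> 1"
      have near: "\<bar>f (\<phi> u) - f (\<phi> x)\<bar> \<le> \<beta>' * (\<bar>u - x\<bar> * norm (b - a))" if "s \<le> u" "u \<le> t" for u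
      proof -
        have "\<bar>u - x\<bar> \<le> d / (norm (b - a) + 1)" using st that by linarith
        then have "\<bar>u - x\<bar> * (norm (b - a) + 1) \<le> d"
          by (simp add: pos_le_divide_eq add_nonneg_pos)
        then have "\<bar>u - x\<bar> * norm (b - a) \<le> d" by (simp add: algebra_simps)
        then show ?thesis
          using d(2)[of "\<phi> u"] seg[OF \<phi>_in[of u]] st01 that by (simp add: \<phi>_dist)
      qed
      have "\<bar>f (\<phi> t) - f (\<phi> s)\<bar> \<le> \<beta>' * ((t - x) * norm (b - a)) + \<beta>' * ((x - s) * norm (b - a))"
        using near[of s] near[of t] st by (simp add: abs_minus_commute)
      then show "\<bar>f (\<phi> t) - f (\<phi> s)\<bar> \<le> \<beta>' * ((t - s) * norm (b - a))"
        by (simp add: algebra_simps)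
    qed
  qed
  then show ?thesis by (simp add: \<phi>_def dist_norm norm_minus_commute)
qed

lemma local_Lip_locally_constant:
  assumes d: "0 < d" "\<And>y. y \<in> unit_square \<Longrightarrow> norm (y - x) < d \<Longrightarrow> f y = f x" and \<beta>: "0 \<le> \<beta>"
  shows "local_Lip f x \<le> ereal \<beta>"
  unfolding local_Lip_def
proof (rule Limsup_bounded)
  have "\<forall>\<^sub>F \<epsilon> in at_right 0. \<epsilon> < d"
    using d(1) by (auto simp: eventually_at_right_field)
  then show "\<forall>\<^sub>F \<epsilon> in at_right 0. (SUP y\<in>{y \<in> unit_square. norm (y - x) \<le> \<epsilon> \<and> y \<noteq> x}.
      ereal (\<bar>f y - f x\<bar> / norm (y - x))) \<le> ereal \<beta>"
  proof eventually_elim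
    case (elim \<epsilon>)
    show ?case
    proof (rule SUP_least)
      fix y assume "y \<in> {y \<in> unit_square. norm (y - x) \<le> \<epsilon> \<and> y \<noteq> x}"
      then have "f y = f x" using d(2)[of y] elim by simp
      then show "ereal (\<bar>f y - f x\<bar> / norm (y - x)) \<le> ereal \<beta>" using \<beta> by simp
    qed
  qed
qed

lemma zero_in_CPLIP: "\<beta> > 0 \<Longrightarrow> (\<lambda>_. 0) \<in> CPLIP L \<beta> N"
  unfolding CPLIP_def complexes_def
  by (auto intro!: exI[of _ "{}"] local_Lip_locally_constant[of 1])

lemma curve_length_linepath: "curve_length (linepath a b) \<le> ennreal (dist a b)"
  unfolding curve_length_def
proof (rule SUP_least, clarify)
  fix t :: "nat \<Rightarrow> real" and m
  assume mono: "mono_on {..m} t" and t: "t ` {..m} \<subseteq> {0..1}"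
  have step: "dist (linepath a b (t (Suc k))) (linepath a b (t k)) = (t (Suc k) - t k) * dist a b"
    if "k < m" for k
  proof -
    have "linepath a b (t (Suc k)) - linepath a b (t k) = (t (Suc k) - t k) *\<^sub>R (b - a)"
      by (simp add: linepath_def algebra_simps)
    moreover have "t k \<le> t (Suc k)" using mono that by (auto simp: monotone_on_def)
    ultimately show ?thesis by (simp add: dist_norm norm_minus_commute)
  qed
  have "(\<Sum>k<m. ennreal (dist (linepath a b (t (Suc k))) (linepath a b (t k))))
      = ennreal (\<Sum>k<m. (t (Suc k) - t k) * dist a b)"
    by (subst sum_ennreal[symmetric]) (auto simp: step[symmetric] simp del: ennreal_mult')
  also have "(\<Sum>k<m. (t (Suc k) - t k) * dist a b) = (t m - t 0) * dist a b"
    by (simp add: sum_lessThan_telescope flip: sum_distrib_right)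
  also have "\<dots> \<le> 1 * dist a b"
  proof (rule mult_right_mono)
    have "t m \<in> {0..1}" "t 0 \<in> {0..1}" using t by auto
    then show "t m - t 0 \<le> 1" by simp
  qed simp
  finally show "(\<Sum>k<m. ennreal (dist (linepath a b (t (Suc k))) (linepath a b (t k)))) \<le> ennreal (dist a b)"
    by (simp add: ennreal_leI)
qed

section \<open>Pixels near a rectifiable curve\<close>

lemma separated_parameters_card:
  assumes len: "curve_length g \<le> ennreal L" "L \<ge> 0" and r: "r > 0"
    and T: "finite T" "T \<subseteq> {0..1}"
    and sep: "\<And>s t. s \<in> T \<Longrightarrow> t \<in> T \<Longrightarrow> s \<noteq> t \<Longrightarrow> r \<le> dist (g s) (g t)"
  shows "real (card T) \<le> L / r + 1"
proof (cases "T = {}")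
  case False
  define xs m where "xs = sorted_list_of_set T" and "m = card T - 1"
  have xs: "sorted xs" "distinct xs" "set xs = T" "length xs = Suc m"
    using T False by (auto simp: xs_def m_def card_gt_0_iff)
  have mem: "xs ! k \<in> T" if "k \<le> m" for k using that xs nth_mem[of k xs] by auto
  have "mono_on {..m} (\<lambda>k. xs ! k)"
    using xs by (auto intro!: mono_onI sorted_nth_mono)
  moreover have "(\<lambda>k. xs ! k) ` {..m} \<subseteq> {0..1}" using mem T by auto
  ultimately have "(\<Sum>k<m. ennreal (dist (g (xs ! Suc k)) (g (xs ! k)))) \<le> curve_length g"
    unfolding curve_length_def by (intro SUP_upper2[of "(\<lambda>k. xs ! k, m)"]) auto
  moreover have "(\<Sum>k<m. ennreal r) \<le> (\<Sum>k<m. ennreal (dist (g (xs ! Suc k)) (g (xs ! k))))"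
  proof (intro sum_mono ennreal_leI)
    fix k assume k: "k \<in> {..<m}"
    then have "xs ! Suc k \<noteq> xs ! k" using xs by (simp add: nth_eq_iff_index_eq)
    then show "r \<le> dist (g (xs ! Suc k)) (g (xs ! k))" using k mem sep by auto
  qed
  ultimately have "ennreal (real m * r) \<le> ennreal L"
    using len r by (simp add: ennreal_of_nat_eq_real_of_nat ennreal_mult)
  then have "real m * r \<le> L" using len r by (simp add: ennreal_le_iff)
  then have "real m \<le> L / r" using r by (simp add: pos_le_divide_eq)
  moreover have "card T = Suc m" using T False by (auto simp: m_def card_gt_0_iff)
  ultimately show ?thesis by simp
qed (use len r in auto)

text \<open>A set of parameters whose images are pairwise \<open>r\<close> apart has at most \<open>L / r + 1\<close> elements, because
  consecutive ones use up length \<open>r\<close> each. In such a set of maximal size no further point of the curve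
  can be \<open>r\<close> away from all the others.\<close>

lemma curve_cover:
  assumes g: "g \<in> rect_curves L" and L: "L \<ge> 0" and r: "r > 0"
  shows "\<exists>T. finite T \<and> real (card T) \<le> L / r + 1 \<and>
             (\<forall>z \<in> path_image g. \<exists>t\<in>T. dist z (g t) < r)"
proof -
  let ?S = "\<lambda>T. finite T \<and> T \<subseteq> {0..1} \<and> (\<forall>s\<in>T. \<forall>t\<in>T. s \<noteq> t \<longrightarrow> r \<le> dist (g s) (g t))"
  have bound: "real (card T) \<le> L / r + 1" if "?S T" for T
    using separated_parameters_card[of g L r T] that g L r unfolding rect_curves_def by blast
  have "\<exists>T. ?S T \<and> (\<forall>U. ?S U \<longrightarrow> card U \<le> card T)"
  proof (rule ex_has_greatest_nat[of ?S "{}" _ "Suc (nat \<lceil>L / r + 1\<rceil>)"])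
    show "\<forall>T. ?S T \<longrightarrow> card T < Suc (nat \<lceil>L / r + 1\<rceil>)"
    proof (intro allI impI)
      fix T assume "?S T"
      from bound[OF this] show "card T < Suc (nat \<lceil>L / r + 1\<rceil>)" by linarith
    qed
  qed simp
  then obtain T where T: "?S T" and max: "\<And>U. ?S U \<Longrightarrow> card U \<le> card T" by blast
  have "\<exists>t\<in>T. dist z (g t) < r" if z: "z \<in> path_image g" for z
  proof (rule ccontr)
    assume far: "\<not> (\<exists>t\<in>T. dist z (g t) < r)"
    obtain s where s: "s \<in> {0..1}" "z = g s" using z by (auto simp: path_image_def)
    have "s \<notin> T" using far s r by auto
    moreover have "?S (insert s T)" using T s far by (auto simp: not_less dist_commute)
    ultimately show False using max[of "insert s T"] T by simp
  qed
  then show ?thesis using T bound by blast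
qed

lemma card_nat_near:
  fixes c r :: real
  assumes "r \<ge> 0"
  shows "finite {k::nat. \<bar>real k - c\<bar> \<le> r}" "real (card {k::nat. \<bar>real k - c\<bar> \<le> r}) \<le> 2 * r + 1"
proof -
  have sub: "{k::nat. \<bar>real k - c\<bar> \<le> r} \<subseteq> nat ` {\<lceil>c - r\<rceil>..\<lfloor>c + r\<rfloor>}"
  proof
    fix k :: nat assume "k \<in> {k. \<bar>real k - c\<bar> \<le> r}"
    then have "int k \<in> {\<lceil>c - r\<rceil>..\<lfloor>c + r\<rfloor>}" by (auto simp: ceiling_le_iff le_floor_iff abs_le_iff)
    then show "k \<in> nat ` {\<lceil>c - r\<rceil>..\<lfloor>c + r\<rfloor>}" by force
  qed
  then show "finite {k::nat. \<bar>real k - c\<bar> \<le> r}" by (rule finite_subset) simp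
  have "card {k::nat. \<bar>real k - c\<bar> \<le> r} \<le> card {\<lceil>c - r\<rceil>..\<lfloor>c + r\<rfloor>}"
    using card_mono[OF _ sub] card_image_le[of "{\<lceil>c - r\<rceil>..\<lfloor>c + r\<rfloor>}" nat] by simp
  then have "real (card {k::nat. \<bar>real k - c\<bar> \<le> r}) \<le> real (nat (\<lfloor>c + r\<rfloor> - \<lceil>c - r\<rceil> + 1))" by simp
  also have "\<dots> \<le> 2 * r + 1" using assms by linarith
  finally show "real (card {k::nat. \<bar>real k - c\<bar> \<le> r}) \<le> 2 * r + 1" .
qed

lemma card_product_near:
  fixes c r :: real
  assumes "r \<ge> 0" and sub: "A \<subseteq> {k. \<bar>real k - c\<bar> \<le> r} \<times> {k. \<bar>real k - d\<bar> \<le> r}"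
  shows "real (card A) \<le> (2 * r + 1)\<^sup>2"
proof -
  have "real (card A) \<le> real (card ({k. \<bar>real k - c\<bar> \<le> r} \<times> {k. \<bar>real k - d\<bar> \<le> r}))"
    using card_mono[OF _ sub] card_nat_near(1)[OF assms(1)] by (simp only: of_nat_le_iff finite_cartesian_product)
  also have "\<dots> \<le> (2 * r + 1) * (2 * r + 1)"
    unfolding card_cartesian_product of_nat_mult
    by (intro mult_mono card_nat_near) (use assms in auto)
  finally show ?thesis by (simp add: power2_eq_square)
qed

lemma card_grid_near:
  assumes "n > 0" "r \<ge> 0"
  shows "real (card {i \<in> grid n. dist (grid_point n i) c \<le> r}) \<le> (2 * (real n * r) + 1)\<^sup>2"
proof (rule card_product_near)
  show "{i \<in> grid n. dist (grid_point n i) c \<le> r}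
    \<subseteq> {k. \<bar>real k - real n * fst c\<bar> \<le> real n * r} \<times> {k. \<bar>real k - real n * snd c\<bar> \<le> real n * r}"
  proof
    fix i assume "i \<in> {i \<in> grid n. dist (grid_point n i) c \<le> r}"
    then have i: "dist (grid_point n i) c \<le> r" by simp
    have scale: "\<bar>k - real n * x\<bar> \<le> real n * r" if "\<bar>k / real n - x\<bar> \<le> r" for k x :: real
    proof -
      have "\<bar>k - real n * x\<bar> = real n * \<bar>k / real n - x\<bar>"
        using assms(1) by (simp add: abs_mult_pos' right_diff_distrib)
      then show ?thesis using that assms(1) by simp
    qed
    have "\<bar>real (fst i) / real n - fst c\<bar> \<le> r" "\<bar>real (snd i) / real n - snd c\<bar> \<le> r"
      using i dist_fst_le[of "grid_point n i" c] dist_snd_le[of "grid_point n i" c]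
      by (auto simp: grid_point_def dist_real_def)
    then show "i \<in> {k. \<bar>real k - real n * fst c\<bar> \<le> real n * r} \<times> {k. \<bar>real k - real n * snd c\<bar> \<le> real n * r}"
      by (auto simp: mem_Times_iff intro: scale)
  qed
qed (use assms in auto)

text \<open>With \<open>n h \<ge> 1\<close> and \<open>h \<le> 1\<close> this is of order \<open>n\<^sup>2 h\<close>: about \<open>1 / h\<close> discs of radius \<open>2 h\<close>, each with
  \<open>O((n h)\<^sup>2)\<close> pixels.\<close>

lemma card_tube:
  assumes K: "K \<in> complexes N L" and n: "n > 0" and h: "h > 0" and L: "L \<ge> 0"
  shows "real (card {i \<in> grid n. \<exists>g\<in>K. \<exists>z\<in>path_image g. dist (grid_point n i) z \<le> h})
         \<le> real N * (L / h + 1) * (4 * (real n * h) + 1)\<^sup>2" (is "real (card ?B) \<le> _")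
proof -
  have K': "K \<subseteq> rect_curves L" "finite K" "card K \<le> N" using K by (auto simp: complexes_def)
  define A where "A c = {i \<in> grid n. dist (grid_point n i) c \<le> 2 * h}" for c
  have A: "real (card (A c)) \<le> (4 * (real n * h) + 1)\<^sup>2" for c
    using card_grid_near[OF n, of "2*h" c] h by (simp add: A_def mult.assoc mult.left_commute)
  have "\<forall>g\<in>K. \<exists>T. finite T \<and> real (card T) \<le> L / h + 1 \<and>
             (\<forall>z \<in> path_image g. \<exists>t\<in>T. dist z (g t) < h)"
    using curve_cover K' L h by blast
  then obtain T where T: "\<And>g. g \<in> K \<Longrightarrow> finite (T g)" "\<And>g. g \<in> K \<Longrightarrow> real (card (T g)) \<le> L / h + 1"
    "\<And>g z. g \<in> K \<Longrightarrow> z \<in> path_image g \<Longrightarrow> \<exists>t\<in>T g. dist z (g t) < h"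
    by metis
  have sub: "?B \<subseteq> (\<Union>g\<in>K. \<Union>t\<in>T g. A (g t))"
  proof
    fix i assume "i \<in> ?B"
    then obtain g z where i: "i \<in> grid n" "g \<in> K" "z \<in> path_image g" "dist (grid_point n i) z \<le> h" by auto
    then obtain t where t: "t \<in> T g" "dist z (g t) < h" using T(3) by blast
    then have "dist (grid_point n i) (g t) \<le> 2 * h"
      using i dist_triangle[of "grid_point n i" "g t" z] by linarith
    then show "i \<in> (\<Union>g\<in>K. \<Union>t\<in>T g. A (g t))" using i t by (auto simp: A_def)
  qed
  have fin: "finite (\<Union>g\<in>K. \<Union>t\<in>T g. A (g t))"
    using K' T by (auto simp: A_def)
  have "card ?B \<le> card (\<Union>g\<in>K. \<Union>t\<in>T g. A (g t))"
    by (rule card_mono[OF fin sub])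
  also have "\<dots> \<le> (\<Sum>g\<in>K. card (\<Union>t\<in>T g. A (g t)))" by (rule card_UN_le[OF K'(2)])
  also have "\<dots> \<le> (\<Sum>g\<in>K. \<Sum>t\<in>T g. card (A (g t)))"
    by (intro sum_mono card_UN_le T)
  finally have "real (card ?B) \<le> (\<Sum>g\<in>K. \<Sum>t\<in>T g. real (card (A (g t))))"
    by (simp flip: of_nat_sum)
  also have "\<dots> \<le> (\<Sum>g\<in>K. \<Sum>t\<in>T g. (4 * (real n * h) + 1)\<^sup>2)"
    by (intro sum_mono A)
  also have "\<dots> = (\<Sum>g\<in>K. real (card (T g)) * (4 * (real n * h) + 1)\<^sup>2)" by simp
  also have "\<dots> \<le> (\<Sum>g\<in>K. (L / h + 1) * (4 * (real n * h) + 1)\<^sup>2)"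
    by (intro sum_mono mult_right_mono T) auto
  also have "\<dots> = real (card K) * ((L / h + 1) * (4 * (real n * h) + 1)\<^sup>2)" by simp
  also have "\<dots> \<le> real N * ((L / h + 1) * (4 * (real n * h) + 1)\<^sup>2)"
    by (intro mult_right_mono mult_nonneg_nonneg) (use K' L h in auto)
  finally show ?thesis by (simp add: mult.assoc)
qed

section \<open>Windows\<close>

lemma grid_point_in_unit_square: "i \<in> grid n \<Longrightarrow> grid_point n i \<in> unit_square"
  by (auto simp: grid_def grid_point_def unit_square_def divide_simps)

lemma window_dist:
  assumes "j \<in> window n h i" "n > 0"
  shows "dist (grid_point n j) (grid_point n i) \<le> h"
proof -
  have "grid_point n j - grid_point n i =
      (1 / real n) *\<^sub>R (real (fst j) - real (fst i), real (snd j) - real (snd i))"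
    by (simp add: grid_point_def diff_divide_distrib)
  then have "dist (grid_point n j) (grid_point n i) =
      norm (real (fst j) - real (fst i), real (snd j) - real (snd i)) / real n"
    unfolding dist_norm by (simp only: norm_scaleR) simp
  also have "\<dots> \<le> h" using assms by (simp add: window_def divide_le_eq mult.commute)
  finally show ?thesis .
qed

lemma self_in_window: "i \<in> grid n \<Longrightarrow> h \<ge> 0 \<Longrightarrow> i \<in> window n h i"
  by (simp add: window_def)

lemma window_mono: "h \<le> h' \<Longrightarrow> window n h i \<subseteq> window n h' i"
  by (auto simp: window_def intro: order_trans[OF _ mult_left_mono])

lemma window_subset_product:
  "window n h i \<subseteq> {k. \<bar>real k - real (fst i)\<bar> \<le> real n * h} \<times> {k. \<bar>real k - real (snd i)\<bar> \<le> real n * h}"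
proof
  fix j assume "j \<in> window n h i"
  then have "norm (real (fst j) - real (fst i), real (snd j) - real (snd i)) \<le> real n * h"
    by (simp add: window_def)
  then show "j \<in> {k. \<bar>real k - real (fst i)\<bar> \<le> real n * h} \<times> {k. \<bar>real k - real (snd i)\<bar> \<le> real n * h}"
    using norm_fst_le[of "real (fst j) - real (fst i)" "real (snd j) - real (snd i)"]
      norm_snd_le[of "real (snd j) - real (snd i)" "real (fst j) - real (fst i)"]
    by (auto simp: mem_Times_iff)
qed

lemma card_window_le:
  assumes "h \<ge> 0"
  shows "real (card (window n h i)) \<le> (2 * (real n * h) + 1)\<^sup>2"
  by (rule card_product_near[OF _ window_subset_product]) (use assms in auto)

text \<open>Even at a corner of the image one quadrant of the disc stays inside it. The interval \<open>J a\<close> points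
  from the coordinate \<open>a\<close> towards the farther side, and \<open>h \<le> 1\<close> makes it fit.\<close>

lemma card_window_ge:
  assumes i: "i \<in> grid n" and h: "0 \<le> h" "h \<le> 1"
  shows "(real n * h)\<^sup>2 / 4 \<le> real (card (window n h i))"
proof -
  define k where "k = nat \<lfloor>real n * h / 2\<rfloor>"
  have nh: "0 \<le> real n * h" "real n * h \<le> real n" using h by (auto simp: mult_left_le)
  have k: "real k \<le> real n * h / 2" "real n * h / 2 \<le> real k + 1"
    using nh unfolding k_def by linarith+
  have kn: "2 * k \<le> n" using k nh by linarith
  define J where "J a = (if 2 * a \<le> n then {a..a + k} else {a - k..a})" for a :: nat
  have J: "J a \<subseteq> {1..n}" "card (J a) = k + 1" "\<And>b. b \<in> J a \<Longrightarrow> \<bar>real b - real a\<bar> \<le> real k"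
    if "a \<in> {1..n}" for a
    using that kn by (auto simp: J_def split: if_splits)
  have i': "fst i \<in> {1..n}" "snd i \<in> {1..n}" using i by (auto simp: grid_def)
  have "J (fst i) \<times> J (snd i) \<subseteq> window n h i"
  proof
    fix j assume j: "j \<in> J (fst i) \<times> J (snd i)"
    have "norm (real (fst j) - real (fst i), real (snd j) - real (snd i))
        \<le> \<bar>real (fst j) - real (fst i)\<bar> + \<bar>real (snd j) - real (snd i)\<bar>"
      using norm_Pair_le[of "real (fst j) - real (fst i)" "real (snd j) - real (snd i)"] by simp
    also have "\<dots> \<le> real k + real k"
      using J(3)[OF i'(1), of "fst j"] J(3)[OF i'(2), of "snd j"] j by (auto simp: mem_Times_iff)
    also have "\<dots> \<le> real n * h" using k by simp
    finally show "j \<in> window n h i"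
      using j J(1)[OF i'(1)] J(1)[OF i'(2)] by (auto simp: window_def grid_def mem_Times_iff)
  qed
  then have "card (J (fst i) \<times> J (snd i)) \<le> card (window n h i)" by (intro card_mono) auto
  then have "real ((k + 1) * (k + 1)) \<le> real (card (window n h i))"
    unfolding card_cartesian_product J(2)[OF i'(1)] J(2)[OF i'(2)] of_nat_le_iff .
  then have "(real k + 1) * (real k + 1) \<le> real (card (window n h i))" by (simp add: algebra_simps)
  moreover have "(real n * h / 2) * (real n * h / 2) \<le> (real k + 1) * (real k + 1)"
    using k nh by (intro mult_mono) auto
  ultimately show ?thesis by (simp add: power2_eq_square)
qed

section \<open>The noise law\<close>

locale noise_law =
  fixes \<Psi> :: "real measure" and \<psi> :: "real \<Rightarrow> real"
  assumes shape: "shape_cond \<Psi> \<psi>" and decay: "decay_exponent \<psi> > 1" and prob: "prob_space \<Psi>"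
begin

sublocale prob_space \<Psi> by (rule prob)

lemma psi_nonneg: "0 \<le> \<psi> x" and psi_symmetric: "\<psi> (- x) = \<psi> x"
  and psi_continuous: "continuous_on UNIV \<psi>" and law_eq: "\<Psi> = density lborel (\<lambda>x. ennreal (\<psi> x))"
  and psi_unimodal: "unimodal \<psi>"
  using shape by (auto simp: shape_cond_def)

lemma psi_measurable [measurable]: "\<psi> \<in> borel_measurable borel"
  using psi_continuous by (simp add: borel_measurable_continuous_onI)

lemma sets_law [measurable_cong, simp]: "sets \<Psi> = sets borel" and space_law [simp]: "space \<Psi> = UNIV"
  by (simp_all add: law_eq)

lemma emeasure_law: "A \<in> sets borel \<Longrightarrow> emeasure \<Psi> A = (\<integral>\<^sup>+x. ennreal (\<psi> x) * indicator A x \<partial>lborel)"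
  by (subst law_eq, subst emeasure_density) auto

lemma prob_singleton: "prob {x} = 0"
proof -
  have "emeasure \<Psi> {x} = 0"
    by (subst law_eq, subst emeasure_density) (auto simp: nn_integral_indicator_singleton')
  then show ?thesis by (simp add: measure_def)
qed

lemma distr_uminus: "distr \<Psi> borel uminus = \<Psi>"
proof (rule measure_eqI)
  fix A assume "A \<in> sets (distr \<Psi> borel uminus)"
  then have A [measurable]: "A \<in> sets borel" by simp
  have *: "uminus -` A \<in> sets borel" using measurable_sets[OF borel_measurable_uminus[OF measurable_ident], of A] A
    by (simp add: measurable_sets)
  have "emeasure (distr \<Psi> borel uminus) A = emeasure \<Psi> (uminus -` A)"
    by (subst emeasure_distr) auto
  also have "\<dots> = (\<integral>\<^sup>+x. ennreal (\<psi> x) * indicator (uminus -` A) x \<partial>lborel)"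
    by (rule emeasure_law[OF *])
  also have "\<dots> = (\<integral>\<^sup>+x. ennreal (\<psi> (- x)) * indicator A (- x) \<partial>lborel)"
    by (simp add: psi_symmetric indicator_vimage comp_def)
  also have "\<dots> = (\<integral>\<^sup>+x. ennreal (\<psi> x) * indicator A x \<partial>lborel)"
    using nn_integral_real_affine[of "\<lambda>x. ennreal (\<psi> x) * indicator A x" "-1" 0] by simp
  also have "\<dots> = emeasure \<Psi> A" by (rule emeasure_law[symmetric]) simp
  finally show "emeasure (distr \<Psi> borel uminus) A = emeasure \<Psi> A" .
qed simp

lemma prob_lessThan_minus: "prob {..<- t} = prob {t<..}"
proof -
  have "prob {t<..} = measure (distr \<Psi> borel uminus) {t<..}" by (simp add: distr_uminus)
  also have "\<dots> = prob {..<- t}"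
    by (subst measure_distr) (auto intro!: arg_cong[where f=prob])
  finally show ?thesis by simp
qed

lemma prob_positive: "prob {0<..} = 1 / 2"
proof -
  have "{..<0} \<union> {0} \<union> {0<..} = (UNIV :: real set)" by auto
  then have "1 = prob ({..<0} \<union> {0} \<union> {0<..})" using prob_space by simp
  also have "\<dots> = prob {..<0} + prob {0} + prob {0<..}"
    by (subst finite_measure_Union; (subst finite_measure_Union)?) auto
  also have "\<dots> = 2 * prob {0<..}" using prob_lessThan_minus[of 0] by (simp add: prob_singleton)
  finally show ?thesis by simp
qed

text \<open>If the density vanished at the centre of symmetry, it would vanish on the half line on the far side
  of \<open>0\<close> from its mode, hence everywhere by symmetry.\<close>

lemma psi_zero_pos: "0 < \<psi> 0"
proof (rule ccontr)
  assume "\<not> 0 < \<psi> 0"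
  then have zero: "\<psi> 0 = 0" using psi_nonneg[of 0] by simp
  obtain m where m: "mono_on {..m} \<psi>" "antimono_on {m..} \<psi>" using psi_unimodal by (auto simp: unimodal_def)
  have "\<psi> x = 0" for x
  proof (cases "0 \<le> m")
    case True
    have "\<psi> (- \<bar>x\<bar>) \<le> \<psi> 0" using m(1) True by (auto simp: monotone_on_def)
    then show ?thesis using zero psi_nonneg[of x] psi_symmetric[of x] by (auto simp: abs_if split: if_splits)
  next
    case False
    have "\<psi> \<bar>x\<bar> \<le> \<psi> 0" using m(2) False by (auto simp: monotone_on_def)
    then show ?thesis using zero psi_nonneg[of x] psi_symmetric[of x] by (auto simp: abs_if split: if_splits)
  qed
  then have "emeasure \<Psi> UNIV = 0" by (subst emeasure_law) auto
  then show False using emeasure_space_1 by simp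
qed

lemma psi_decay: obtains s C where "s > 1" "C > 0" "\<And>x. \<psi> x \<le> C * (\<bar>x\<bar> + 1) powr (- s)"
proof -
  obtain s where s: "1 < ereal s" "0 < s" "bounded (range (\<lambda>x. \<psi> x * (\<bar>x\<bar> + 1) powr s))"
    using decay unfolding decay_exponent_def less_SUP_iff by auto
  then obtain C where C: "C > 0" "\<And>x. norm (\<psi> x * (\<bar>x\<bar> + 1) powr s) \<le> C"
    unfolding bounded_pos by auto
  have "\<psi> x \<le> C * (\<bar>x\<bar> + 1) powr (- s)" for x
    using C(2)[of x] by (simp add: powr_minus field_simps)
  then show thesis using that[of s C] s C by (simp add: one_ereal_def)
qed

lemma psi_bounded: obtains B where "B > 0" "\<And>x. \<psi> x \<le> B"
proof -
  obtain s C where sC: "s > 1" "C > 0" "\<And>x. \<psi> x \<le> C * (\<bar>x\<bar> + 1) powr (- s)" by (rule psi_decay) blast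
  have "\<psi> x \<le> C" for x
  proof -
    have "(\<bar>x\<bar> + 1) powr (- s) \<le> 1" using sC(1) by (simp add: powr_minus ge_one_powr_ge_zero inverse_le_1_iff)
    then show ?thesis using sC(3)[of x] sC(2) mult_left_le[of "(\<bar>x\<bar> + 1) powr (- s)" C] by linarith
  qed
  then show thesis using that sC by blast
qed

lemma prob_near_zero: obtains B where "B > 0" "\<And>u. u \<ge> 0 \<Longrightarrow> prob {-u..u} \<le> B * u"
proof -
  obtain B where B: "B > 0" "\<And>x. \<psi> x \<le> B" by (rule psi_bounded) blast
  have "prob {-u..u} \<le> 2 * B * u" if u: "u \<ge> 0" for u
  proof -
    have "emeasure \<Psi> {-u..u} = (\<integral>\<^sup>+x. ennreal (\<psi> x) * indicator {-u..u} x \<partial>lborel)"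
      by (rule emeasure_law) simp
    also have "\<dots> \<le> (\<integral>\<^sup>+x. ennreal B * indicator {-u..u} x \<partial>lborel)"
      using B by (intro nn_integral_mono mult_right_mono ennreal_leI) auto
    also have "\<dots> = ennreal (2 * B * u)"
      using u B by (simp add: nn_integral_cmult_indicator ennreal_mult'[symmetric])
    finally show ?thesis using u B by (simp add: emeasure_eq_measure ennreal_le_iff)
  qed
  then show thesis using that[of "2 * B"] B by simp
qed

text \<open>Continuity keeps \<open>\<psi>\<close> above \<open>\<psi> 0 / 2\<close> near \<open>0\<close>, so the tail leaves the value \<open>1 / 2\<close> at a
  positive rate. This makes the median concentrate at the parametric rate.\<close>

lemma tail_linear: obtains c \<delta> where "c > 0" "\<delta> > 0" "\<And>t. 0 \<le> t \<Longrightarrow> t \<le> \<delta> \<Longrightarrow> prob {t<..} \<le> 1 / 2 - c * t"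
proof -
  have "isCont \<psi> 0" using psi_continuous by (simp add: continuous_on_eq_continuous_at)
  then have "\<exists>d>0. \<forall>x. \<bar>x - 0\<bar> < d \<longrightarrow> \<bar>\<psi> x - \<psi> 0\<bar> < \<psi> 0 / 2"
    using psi_zero_pos unfolding continuous_at_eps_delta dist_real_def
    by (elim allE[of _ "\<psi> 0 / 2"]) simp
  then obtain d where d: "d > 0" "\<And>x. \<bar>x\<bar> < d \<Longrightarrow> \<bar>\<psi> x - \<psi> 0\<bar> < \<psi> 0 / 2" by auto
  have low: "\<psi> 0 / 2 \<le> \<psi> x" if "\<bar>x\<bar> < d" for x using d(2)[OF that] by linarith
  have "prob {t<..} \<le> 1 / 2 - (\<psi> 0 / 2) * t" if t: "0 \<le> t" "t \<le> d / 2" for t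
  proof -
    have "ennreal (\<psi> 0 / 2 * t) = (\<integral>\<^sup>+x. ennreal (\<psi> 0 / 2) * indicator {0<..t} x \<partial>lborel)"
      using t psi_zero_pos by (simp add: nn_integral_cmult_indicator ennreal_mult'[symmetric])
    also have "\<dots> \<le> (\<integral>\<^sup>+x. ennreal (\<psi> x) * indicator {0<..t} x \<partial>lborel)"
    proof (rule nn_integral_mono)
      fix x
      show "ennreal (\<psi> 0 / 2) * indicator {0<..t} x \<le> ennreal (\<psi> x) * indicator {0<..t} x"
        using low[of x] t d by (auto split: split_indicator intro!: ennreal_leI)
    qed
    also have "\<dots> = emeasure \<Psi> {0<..t}" by (rule emeasure_law[symmetric]) simp
    finally have "\<psi> 0 / 2 * t \<le> prob {0<..t}" by (simp add: emeasure_eq_measure)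
    moreover have "prob {0<..} = prob {0<..t} + prob {t<..}"
      using t by (subst finite_measure_Union[symmetric]) (auto intro!: arg_cong[where f=prob])
    ultimately show ?thesis using prob_positive by simp
  qed
  then show thesis using that[of "\<psi> 0 / 2" "d / 2"] psi_zero_pos d by simp
qed

text \<open>Integration of the decay condition. Only some positive power is left, so the noise need not
  have any moment of order one, but the median of enough variables has a second moment.\<close>

lemma tail_power: obtains a C where "a > 0" "C > 0" "\<And>t. 0 \<le> t \<Longrightarrow> prob {t<..} \<le> C * (t + 1) powr (- a)"
proof -
  obtain s C where sC: "s > 1" "C > 0" "\<And>x. \<psi> x \<le> C * (\<bar>x\<bar> + 1) powr (- s)" by (rule psi_decay) blast
  have "prob {t<..} \<le> C / (s - 1) * (t + 1) powr (- (s - 1))" if t: "0 \<le> t" for t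
  proof -
    define F where "F x = - (C / (s - 1)) * (x + 1) powr (- (s - 1))" for x :: real
    have "emeasure \<Psi> {t<..} = (\<integral>\<^sup>+x. ennreal (\<psi> x) * indicator {t<..} x \<partial>lborel)"
      by (rule emeasure_law) simp
    also have "\<dots> \<le> (\<integral>\<^sup>+x. ennreal (C * (x + 1) powr (- s)) * indicator {t..} x \<partial>lborel)"
    proof (rule nn_integral_mono)
      fix x
      show "ennreal (\<psi> x) * indicator {t<..} x \<le> ennreal (C * (x + 1) powr (- s)) * indicator {t..} x"
        using sC(3)[of x] t by (auto split: split_indicator intro!: ennreal_leI)
    qed
    also have "\<dots> = ennreal (0 - F t)"
    proof (rule nn_integral_FTC_atLeast)
      show "DERIV F x :> C * (x + 1) powr (- s)" if "t \<le> x" for x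
      proof -
        have "filterlim (\<lambda>x::real. 1 + x) at_top at_top"
        by (rule filterlim_tendsto_add_at_top[OF tendsto_const filterlim_ident])
      then have "((\<lambda>x. (x + 1) powr (- (s - 1))) has_real_derivative
            - (s - 1) * (x + 1) powr (- (s - 1) - of_nat 1) * 1) (at x)"
          using t that by (intro DERIV_fun_powr) (auto intro!: derivative_eq_intros)
        from DERIV_cmult[OF this, of "- (C / (s - 1))"]
        have "DERIV F x :> - (C / (s - 1)) * (- (s - 1) * (x + 1) powr (- (s - 1) - of_nat 1) * 1)"
          unfolding F_def .
        moreover have "- (C / (s - 1)) * (- (s - 1) * (x + 1) powr (- (s - 1) - of_nat 1) * 1)
            = C * (x + 1) powr (- s)"
          using sC(1) by (simp add: field_simps)
        ultimately show ?thesis by simp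
      qed
      have "filterlim (\<lambda>x::real. 1 + x) at_top at_top"
        by (rule filterlim_tendsto_add_at_top[OF tendsto_const filterlim_ident])
      then have "((\<lambda>x. (x + 1) powr (- (s - 1))) \<longlongrightarrow> 0) at_top"
        using sC(1) by (intro tendsto_neg_powr) (auto simp: add.commute)
      then show "(F \<longlongrightarrow> 0) at_top" unfolding F_def using tendsto_mult_right_zero by blast
    qed (use sC in auto)
    finally show ?thesis using sC t unfolding F_def
      by (simp add: emeasure_eq_measure ennreal_le_iff)
  qed
  then show thesis using that[of "s - 1" "C / (s - 1)"] sC by simp
qed

text \<open>The Chernoff bound for a majority among \<open>m\<close> events of probability \<open>p\<close> is
  \<open>(4 p (1 - p)) powr (m / 2)\<close>. One function of \<open>t\<close> dominates \<open>4 p (1 - p)\<close> on the whole half line: it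
  starts like \<open>1 - \<kappa> b t\<^sup>2\<close>, as the linear behaviour of the tail near \<open>0\<close> permits, and it
  falls off as a power of \<open>t\<close> small enough for the polynomial tail.\<close>

lemma tail_product_bound:
  obtains b \<kappa> where "b > 0" "\<kappa> > 0"
    "\<And>t. 0 \<le> t \<Longrightarrow> 4 * prob {t<..} * (1 - prob {t<..}) \<le> (1 + b * t\<^sup>2) powr (- \<kappa>)"
proof -
  obtain c \<delta> where c: "c > 0" "\<delta> > 0" and lin: "\<And>t. 0 \<le> t \<Longrightarrow> t \<le> \<delta> \<Longrightarrow> prob {t<..} \<le> 1 / 2 - c * t"
    by (rule tail_linear) blast
  obtain a C where a: "a > 0" "C > 0" and pow: "\<And>t. 0 \<le> t \<Longrightarrow> prob {t<..} \<le> C * (t + 1) powr (- a)"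
    by (rule tail_power) blast
  define \<kappa> where "\<kappa> = min 1 (a / 4)"
  define T where "T = max \<delta> ((4 * C) powr (2 / a))"
  define b where "b = min 1 (4 * c\<^sup>2 * \<delta>\<^sup>2 / T\<^sup>2)"
  have \<kappa>: "0 < \<kappa>" "\<kappa> \<le> 1" "\<kappa> \<le> a / 4" using a by (auto simp: \<kappa>_def)
  have T: "\<delta> \<le> T" "0 < T" "(4 * C) powr (2 / a) \<le> T" using c by (auto simp: T_def)
  have "0 < 4 * c\<^sup>2 * \<delta>\<^sup>2 / T\<^sup>2" using c T by simp
  then have b: "0 < b" "b \<le> 1" "b \<le> 4 * c\<^sup>2 * \<delta>\<^sup>2 / T\<^sup>2" by (auto simp: b_def)
  \<comment> \<open>On \<open>[\<delta>, T]\<close> the left-hand side is at most its bound at \<open>\<delta>\<close>; this choice of \<open>b\<close> keeps the right-hand side above it up to \<open>T\<close>.\<close>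
  have bT: "b * T\<^sup>2 \<le> 4 * c\<^sup>2 * \<delta>\<^sup>2" using b(3) T by (simp add: pos_le_divide_eq)
  have near: "4 * p * (1 - p) \<le> 1 - 4 * d\<^sup>2" if "p \<le> 1 / 2 - d" "0 \<le> d" for p d :: real
  proof -
    have "d\<^sup>2 \<le> (1 / 2 - p)\<^sup>2" using that by (intro power_mono) auto
    then show ?thesis by (simp add: power2_eq_square algebra_simps)
  qed
  have small: "1 - y \<le> (1 + y) powr (- \<kappa>)" if "0 \<le> y" for y
  proof -
    have "(1 - y) * (1 + y) \<le> 1" by (simp add: algebra_simps)
    then have "1 - y \<le> 1 / (1 + y)" using that by (simp add: pos_le_divide_eq)
    also have "\<dots> = (1 + y) powr (- 1)" using that by (simp add: powr_minus_divide)
    also have "\<dots> \<le> (1 + y) powr (- \<kappa>)" using that \<kappa> by (intro powr_mono) auto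
    finally show ?thesis .
  qed
  have "4 * prob {t<..} * (1 - prob {t<..}) \<le> (1 + b * t\<^sup>2) powr (- \<kappa>)" if t: "0 \<le> t" for t
  proof -
    consider "t \<le> \<delta>" | "\<delta> \<le> t" "t \<le> T" | "T \<le> t" by linarith
    then show ?thesis
    proof cases
      case 1
      have "b * (t\<^sup>2 * T\<^sup>2) \<le> 4 * c\<^sup>2 * t\<^sup>2 * \<delta>\<^sup>2"
        using mult_right_mono[OF bT, of "t\<^sup>2"] by (simp add: mult_ac)
      also have "\<dots> \<le> 4 * c\<^sup>2 * t\<^sup>2 * T\<^sup>2" using T c by (intro mult_left_mono power_mono) auto
      finally have "(b * t\<^sup>2) * T\<^sup>2 \<le> (4 * (c * t)\<^sup>2) * T\<^sup>2" by (simp add: power_mult_distrib mult_ac)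
      then have "b * t\<^sup>2 \<le> 4 * (c * t)\<^sup>2" using T by simp
      then show ?thesis using near[OF lin[OF t 1]] small[of "b * t\<^sup>2"] b c t by simp
    next
      case 2
      have "prob {t<..} \<le> prob {\<delta><..}" using 2 by (intro finite_measure_mono) auto
      then have "prob {t<..} \<le> 1 / 2 - c * \<delta>" using lin[of \<delta>] c by simp
      from near[OF this] have "4 * prob {t<..} * (1 - prob {t<..}) \<le> 1 - 4 * c\<^sup>2 * \<delta>\<^sup>2"
        using c by (simp add: power_mult_distrib)
      moreover have bt: "b * t\<^sup>2 \<le> b * T\<^sup>2" using 2 t b by (intro mult_left_mono power_mono) auto
      moreover have "0 \<le> b * t\<^sup>2" using b by simp
      from small[OF this] have "1 - b * t\<^sup>2 \<le> (1 + b * t\<^sup>2) powr (- \<kappa>)" .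
      ultimately show ?thesis using bT by linarith
    next
      case 3
      have "4 * C = ((4 * C) powr (2 / a)) powr (a / 2)" using a by (simp add: powr_powr)
      also have "\<dots> \<le> (1 + t) powr (a / 2)" using T 3 a t by (intro powr_mono2) auto
      finally have C: "4 * C \<le> (1 + t) powr (a / 2)" .
      have "4 * prob {t<..} * (1 - prob {t<..}) \<le> 4 * prob {t<..} * 1"
        by (intro mult_left_mono) auto
      also have "\<dots> \<le> 4 * C * (1 + t) powr (- a)" using pow[OF t] by (simp add: add.commute)
      also have "\<dots> \<le> (1 + t) powr (a / 2) * (1 + t) powr (- a)" by (intro mult_right_mono C) auto
      also have "\<dots> = (1 + t) powr (- (a / 2))" by (simp flip: powr_add)
      also have "\<dots> \<le> (1 + t) powr (2 * (- \<kappa>))" using \<kappa> t by (intro powr_mono) auto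
      also have "\<dots> = ((1 + t)\<^sup>2) powr (- \<kappa>)" using t by (simp add: powr_powr flip: powr_numeral)
      also have "\<dots> \<le> (1 + b * t\<^sup>2) powr (- \<kappa>)"
      proof (rule powr_mono2')
        have "b * t\<^sup>2 \<le> t\<^sup>2" using b by (simp add: mult_le_cancel_right1 mult_left_le_one_le)
        then show "1 + b * t\<^sup>2 \<le> (1 + t)\<^sup>2" using t by (simp add: power2_sum)
      qed (use \<kappa> b in \<open>auto simp: add_pos_nonneg\<close>)
      finally show ?thesis .
    qed
  qed
  then show thesis using that b \<kappa> by blast
qed

end

section \<open>Counts of independent events\<close>

lemma borel_measurable_card_hits:
  assumes "finite W" "\<And>j. j \<in> W \<Longrightarrow> X j \<in> borel_measurable M" "B \<in> sets borel"
  shows "(\<lambda>\<omega>. real (card {j \<in> W. X j \<omega> \<in> B})) \<in> borel_measurable M"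
proof -
  have "(\<lambda>\<omega>. \<Sum>j\<in>W. indicator B (X j \<omega>) :: real) \<in> borel_measurable M"
    by (intro borel_measurable_sum measurable_compose[OF assms(2)] borel_measurable_indicator assms(3))
  moreover have "(\<Sum>j\<in>W. indicator B (X j \<omega>) :: real) = real (card {j \<in> W. X j \<omega> \<in> B})" for \<omega>
    using assms(1) by (simp add: indicator_def sum.If_cases Int_def)
  ultimately show ?thesis by simp
qed

lemma sets_majority_hits:
  assumes "finite W" "\<And>j. j \<in> W \<Longrightarrow> X j \<in> borel_measurable M" "B \<in> sets borel"
  shows "{\<omega> \<in> space M. card W \<le> 2 * card {j \<in> W. X j \<omega> \<in> B}} \<in> sets M"
proof -
  have [measurable]: "(\<lambda>\<omega>. real (card {j \<in> W. X j \<omega> \<in> B})) \<in> borel_measurable M"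
    by (rule borel_measurable_card_hits[OF assms])
  have "{\<omega> \<in> space M. real (card W) \<le> 2 * real (card {j \<in> W. X j \<omega> \<in> B})} \<in> sets M"
    by measurable
  moreover have "{\<omega> \<in> space M. card W \<le> 2 * card {j \<in> W. X j \<omega> \<in> B}} =
      {\<omega> \<in> space M. real (card W) \<le> 2 * real (card {j \<in> W. X j \<omega> \<in> B})}"
    by (intro Collect_cong conj_cong refl) linarith
  ultimately show ?thesis by simp
qed

lemma (in prob_space) prob_many_hits_le:
  assumes W: "finite W" and X: "\<And>j. j \<in> W \<Longrightarrow> X j \<in> borel_measurable M" and B: "B \<in> sets borel"
    and p: "\<And>j. j \<in> W \<Longrightarrow> prob {\<omega> \<in> space M. X j \<omega> \<in> B} = p" and r: "0 < r"
  shows "prob {\<omega> \<in> space M. r \<le> real (card {j \<in> W. X j \<omega> \<in> B})} \<le> real (card W) * p / r"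
proof -
  let ?c = "\<lambda>\<omega>. real (card {j \<in> W. X j \<omega> \<in> B})"
  have E: "{\<omega> \<in> space M. X j \<omega> \<in> B} \<in> events" if "j \<in> W" for j
    using measurable_sets[OF X[OF that] B] by (simp add: vimage_def Int_def conj_commute)
  have c: "?c \<omega> = (\<Sum>j\<in>W. indicator {\<omega> \<in> space M. X j \<omega> \<in> B} \<omega>)" if "\<omega> \<in> space M" for \<omega>
    using W that by (simp add: indicator_def sum.If_cases Int_def)
  have "expectation ?c = expectation (\<lambda>\<omega>. \<Sum>j\<in>W. indicator {\<omega> \<in> space M. X j \<omega> \<in> B} \<omega>)"
    by (intro Bochner_Integration.integral_cong refl c)
  also have "\<dots> = (\<Sum>j\<in>W. prob {\<omega> \<in> space M. X j \<omega> \<in> B})"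
    using E by (subst Bochner_Integration.integral_sum) (auto simp: emeasure_eq_measure)
  also have "\<dots> = real (card W) * p" using p by simp
  finally have "expectation ?c = real (card W) * p" .
  moreover have "integrable M ?c"
  proof (rule integrable_const_bound[of _ "real (card W)"])
    show "AE \<omega> in M. norm (?c \<omega>) \<le> real (card W)" using W by (auto intro: card_mono)
  qed (rule borel_measurable_card_hits[OF W X B])
  ultimately show ?thesis
    using integral_Markov_inequality_measure[of M ?c "{}" r] r by simp
qed

text \<open>Cutting the values of \<open>g\<close> at the levels \<open>2 ^ k * \<tau>\<close> gives a geometric series with ratio \<open>1 / 4\<close>, since
  squares grow by \<open>4\<close> and tails shrink by \<open>16\<close> from one level to the next. The function \<open>g\<close> is compared with a
  measurable step function, so that the bound applies to medians without a proof of their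
  measurability.\<close>

lemma (in prob_space) second_moment_of_quartic_tail:
  fixes g :: "'a \<Rightarrow> real" and A :: "real \<Rightarrow> 'a set"
  assumes A [measurable]: "\<And>t. A t \<in> events" and g: "\<And>\<omega>. 0 \<le> g \<omega>"
    and sub: "\<And>\<omega> t. \<omega> \<in> space M \<Longrightarrow> 0 < t \<Longrightarrow> t < g \<omega> \<Longrightarrow> \<omega> \<in> A t"
    and tail: "\<And>t. 0 < t \<Longrightarrow> prob (A t) \<le> (\<tau> / t) ^ 4" and \<tau>: "0 < \<tau>"
    and ac: "0 \<le> a" "0 \<le> c"
  shows "(\<integral>\<^sup>+\<omega>. ennreal (a + c * (g \<omega>)\<^sup>2) \<partial>M) \<le> ennreal (a + c * (7 * \<tau>\<^sup>2))"
proof -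
  define T where "T k = 2 ^ k * \<tau>" for k
  have T: "0 < T k" "T (Suc k) = 2 * T k" "T 0 = \<tau>" for k using \<tau> by (auto simp: T_def)
  let ?u = "\<lambda>k \<omega>. ennreal (4 * (T k)\<^sup>2) * indicator (A (T k)) \<omega>"
  have single: "f l \<le> (\<Sum>k. f k)" for f :: "nat \<Rightarrow> ennreal" and l
    using sum_le_suminf[of f "{l}"] by (simp add: summableI)
  have pointwise: "ennreal ((g \<omega>)\<^sup>2) \<le> ennreal (\<tau>\<^sup>2) + (\<Sum>k. ?u k \<omega>)" if \<omega>: "\<omega> \<in> space M" for \<omega>
  proof (cases "g \<omega> \<le> \<tau>")
    case True
    then have "ennreal ((g \<omega>)\<^sup>2) \<le> ennreal (\<tau>\<^sup>2)" using g by (intro ennreal_leI power_mono) auto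
    then show ?thesis by (simp add: add_increasing2)
  next
    case False
    obtain j where "g \<omega> / \<tau> < 2 ^ j" using real_arch_pow[of 2 "g \<omega> / \<tau>"] by auto
    then have ex: "g \<omega> \<le> T j" using \<tau> by (simp add: T_def divide_simps)
    define k where "k = (LEAST j. g \<omega> \<le> T j)"
    have k: "g \<omega> \<le> T k" unfolding k_def using ex by (rule LeastI[where P = "\<lambda>j. g \<omega> \<le> T j"])
    obtain l where l: "k = Suc l" using k False T(3) by (cases k) auto
    have "\<not> g \<omega> \<le> T l" using not_less_Least[of l "\<lambda>j. g \<omega> \<le> T j"] l by (auto simp: k_def)
    then have "\<omega> \<in> A (T l)" using sub[OF \<omega> T(1)] by simp
    moreover have "(g \<omega>)\<^sup>2 \<le> 4 * (T l)\<^sup>2"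
      using power_mono[OF k g, of 2] by (simp add: l T power_mult_distrib)
    ultimately have "ennreal ((g \<omega>)\<^sup>2) \<le> ?u l \<omega>" by (simp add: ennreal_leI)
    also have "\<dots> \<le> (\<Sum>k. ?u k \<omega>)" by (rule single)
    finally show ?thesis by (simp add: add_increasing)
  qed
  have layer: "ennreal (4 * (T k)\<^sup>2) * emeasure M (A (T k)) \<le> ennreal (4 * \<tau>\<^sup>2 * (1 / 4) ^ k)" for k
  proof -
    have "4 * (T k)\<^sup>2 * prob (A (T k)) \<le> 4 * (T k)\<^sup>2 * (\<tau> / T k) ^ 4"
      by (intro mult_left_mono tail T) auto
    also have "\<dots> = 4 * \<tau>\<^sup>2 * (1 / (2 ^ k)\<^sup>2)"
      using \<tau> by (simp add: T_def power_mult_distrib power_divide divide_simps power2_eq_square eval_nat_numeral)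
    also have "(2 ^ k)\<^sup>2 = (4::real) ^ k" by (simp add: power2_eq_square flip: power_mult_distrib)
    finally show ?thesis
      by (simp add: emeasure_eq_measure ennreal_mult'[symmetric] power_one_over ennreal_leI)
  qed
  have "(\<lambda>k. (1 / 4 :: real) ^ k) sums (1 / (1 - 1 / 4))" by (rule geometric_sums) simp
  then have sums: "(\<lambda>k. 4 * \<tau>\<^sup>2 * (1 / 4) ^ k) sums (4 * \<tau>\<^sup>2 * (1 / (1 - 1 / 4)))"
    by (rule sums_mult)
  have "(\<integral>\<^sup>+\<omega>. ennreal (\<tau>\<^sup>2) + (\<Sum>k. ?u k \<omega>) \<partial>M)
      = ennreal (\<tau>\<^sup>2) + (\<Sum>k. ennreal (4 * (T k)\<^sup>2) * emeasure M (A (T k)))"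
    by (simp add: nn_integral_add nn_integral_suminf nn_integral_cmult_indicator emeasure_space_1)
  also have "\<dots> \<le> ennreal (\<tau>\<^sup>2) + (\<Sum>k. ennreal (4 * \<tau>\<^sup>2 * (1 / 4) ^ k))"
    by (intro add_left_mono suminf_le layer summableI)
  also have "(\<Sum>k. ennreal (4 * \<tau>\<^sup>2 * (1 / 4) ^ k)) = ennreal (4 * \<tau>\<^sup>2 * (1 / (1 - 1 / 4)))"
    by (rule suminf_ennreal_eq[OF _ sums]) simp
  also have "ennreal (\<tau>\<^sup>2) + \<dots> = ennreal (\<tau>\<^sup>2 + 4 * \<tau>\<^sup>2 * (1 / (1 - 1 / 4)))"
    by (rule ennreal_plus[symmetric]) simp_all
  also have "\<dots> \<le> ennreal (7 * \<tau>\<^sup>2)" by (intro ennreal_leI) simp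
  finally have u: "(\<integral>\<^sup>+\<omega>. ennreal (\<tau>\<^sup>2) + (\<Sum>k. ?u k \<omega>) \<partial>M) \<le> ennreal (7 * \<tau>\<^sup>2)" .
  have "(\<integral>\<^sup>+\<omega>. ennreal (a + c * (g \<omega>)\<^sup>2) \<partial>M)
      \<le> (\<integral>\<^sup>+\<omega>. ennreal a + ennreal c * (ennreal (\<tau>\<^sup>2) + (\<Sum>k. ?u k \<omega>)) \<partial>M)"
  proof (rule nn_integral_mono)
    fix \<omega> assume "\<omega> \<in> space M"
    from mult_left_mono[OF pointwise[OF this], of "ennreal c"]
    show "ennreal (a + c * (g \<omega>)\<^sup>2) \<le> ennreal a + ennreal c * (ennreal (\<tau>\<^sup>2) + (\<Sum>k. ?u k \<omega>))"
      using ac by (simp add: ennreal_mult add_left_mono)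
  qed
  also have "\<dots> = ennreal a + ennreal c * (\<integral>\<^sup>+\<omega>. ennreal (\<tau>\<^sup>2) + (\<Sum>k. ?u k \<omega>) \<partial>M)"
    by (subst nn_integral_add) (auto simp: nn_integral_cmult emeasure_space_1)
  also have "\<dots> \<le> ennreal a + ennreal c * ennreal (7 * \<tau>\<^sup>2)"
    by (intro add_left_mono mult_left_mono u) auto
  also have "\<dots> = ennreal (a + c * (7 * \<tau>\<^sup>2))" using ac by (simp add: ennreal_mult)
  finally show ?thesis .
qed

text \<open>The optimal exponential tilt is \<open>s = sqrt ((1 - p) / p)\<close>, which gives \<open>sqrt (4 p (1 - p))\<close>. For \<open>p = 0\<close> the
  infimum is only approached as \<open>s\<close> grows; this is why \<open>Q\<close> is positive.\<close>

lemma chernoff_tilt: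
  fixes p Q :: real
  assumes "0 \<le> p" "p \<le> 1 / 2" "4 * p * (1 - p) \<le> Q" "0 < Q" "Q \<le> 1"
  obtains s where "s \<ge> 1" "p * s + (1 - p) / s \<le> sqrt Q"
proof (cases "p = 0")
  case True
  show thesis
    by (rule that[of "1 / sqrt Q"]) (use assms True in auto)
next
  case False
  define s where "s = sqrt ((1 - p) / p)"
  have "1 \<le> (1 - p) / p" using assms False by (simp add: le_divide_eq)
  then have s1: "s \<ge> 1" by (simp add: s_def)
  have ss: "s\<^sup>2 = (1 - p) / p" using assms False by (simp add: s_def)
  have "(p * s + (1 - p) / s)\<^sup>2 = p\<^sup>2 * s\<^sup>2 + 2 * p * (1 - p) + (1 - p)\<^sup>2 / s\<^sup>2"
    using s1 by (simp add: power2_sum power_mult_distrib power_divide)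
  also have "\<dots> = 4 * p * (1 - p)"
    using assms False unfolding ss by (simp add: field_simps power2_eq_square)
  finally have "(p * s + (1 - p) / s)\<^sup>2 \<le> Q" using assms by simp
  then show thesis using that[of s] s1 by (auto intro: real_le_rsqrt)
qed

text \<open>Each variable contributes a factor \<open>s\<close> if it hits \<open>B\<close> and \<open>1 / s\<close> otherwise. The product is at
  least \<open>1\<close> when at least half of them hit, and its mean factorizes.\<close>

lemma (in prob_space) majority_chernoff:
  fixes X :: "'i \<Rightarrow> 'a \<Rightarrow> real"
  assumes W: "finite W" and ind: "indep_vars (\<lambda>_. borel) X W" and B [measurable]: "B \<in> sets borel"
    and p: "\<And>j. j \<in> W \<Longrightarrow> prob {\<omega> \<in> space M. X j \<omega> \<in> B} = p"
    and Q: "0 \<le> p" "p \<le> 1 / 2" "4 * p * (1 - p) \<le> Q" "0 < Q" "Q \<le> 1"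
  shows "prob {\<omega> \<in> space M. card W \<le> 2 * card {j \<in> W. X j \<omega> \<in> B}} \<le> sqrt Q ^ card W"
proof -
  obtain s where s: "s \<ge> 1" "p * s + (1 - p) / s \<le> sqrt Q" using chernoff_tilt[OF Q] by blast
  define y where "y x = (if x \<in> B then s else 1 / s)" for x
  have y [measurable]: "y \<in> borel_measurable borel" unfolding y_def by measurable
  have y0: "0 < y x" for x using s by (simp add: y_def)
  have X [measurable]: "X j \<in> borel_measurable M" if "j \<in> W" for j
    using ind that by (auto simp: indep_vars_def)
  have mean: "(\<integral>\<^sup>+\<omega>. ennreal (y (X j \<omega>)) \<partial>M) = ennreal (p * s + (1 - p) / s)" if j: "j \<in> W" for j
  proof -
    note [measurable] = X[OF j]
    let ?E = "{\<omega> \<in> space M. X j \<omega> \<in> B}"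
    have "(\<integral>\<^sup>+\<omega>. ennreal (y (X j \<omega>)) \<partial>M)
        = (\<integral>\<^sup>+\<omega>. ennreal s * indicator ?E \<omega> + ennreal (1 / s) * indicator (space M - ?E) \<omega> \<partial>M)"
      by (intro nn_integral_cong) (auto simp: y_def split: split_indicator)
    also have "\<dots> = ennreal s * emeasure M ?E + ennreal (1 / s) * emeasure M (space M - ?E)"
      by (subst nn_integral_add) (auto simp: nn_integral_cmult_indicator)
    also have "\<dots> = ennreal (s * p) + ennreal (1 / s * (1 - p))"
      using s p[OF j] by (simp add: emeasure_eq_measure prob_compl ennreal_mult'[symmetric])
    finally show ?thesis using s Q by (simp add: mult.commute flip: ennreal_plus)
  qed
  have ind': "indep_vars (\<lambda>_. borel) (\<lambda>j \<omega>. ennreal (y (X j \<omega>))) W"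
    by (rule indep_vars_compose2[OF ind]) measurable
  have big: "1 \<le> (\<Prod>j\<in>W. y (X j \<omega>))" if c: "card W \<le> 2 * card {j \<in> W. X j \<omega> \<in> B}" for \<omega>
  proof -
    let ?P = "{j \<in> W. X j \<omega> \<in> B}"
    have cd: "card (W - ?P) = card W - card ?P" "card ?P \<le> card W"
      using W by (auto intro: card_Diff_subset card_mono)
    have "(\<Prod>j\<in>W. y (X j \<omega>)) = (\<Prod>j\<in>?P. y (X j \<omega>)) * (\<Prod>j\<in>W - ?P. y (X j \<omega>))"
      using prod.subset_diff[of ?P W "\<lambda>j. y (X j \<omega>)"] W by (simp add: mult.commute)
    also have "\<dots> = s ^ card ?P * (1 / s) ^ card (W - ?P)" by (simp add: y_def)
    also have "\<dots> = s ^ card ?P / s ^ card (W - ?P)" by (simp add: power_one_over)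
    also have "\<dots> \<ge> 1" using s cd c by (simp add: power_increasing)
    finally show ?thesis .
  qed
  let ?A = "{\<omega> \<in> space M. card W \<le> 2 * card {j \<in> W. X j \<omega> \<in> B}}"
  have [measurable]: "?A \<in> events" by (rule sets_majority_hits[OF W X B])
  have "emeasure M ?A = (\<integral>\<^sup>+\<omega>. indicator ?A \<omega> \<partial>M)" by simp
  also have "\<dots> \<le> (\<integral>\<^sup>+\<omega>. (\<Prod>j\<in>W. ennreal (y (X j \<omega>))) \<partial>M)"
  proof (rule nn_integral_mono)
    fix \<omega>
    show "indicator ?A \<omega> \<le> (\<Prod>j\<in>W. ennreal (y (X j \<omega>)))"
      using big[of \<omega>] y0 by (auto split: split_indicator simp: prod_ennreal less_imp_le)
  qed
  also have "\<dots> = (\<Prod>j\<in>W. \<integral>\<^sup>+\<omega>. ennreal (y (X j \<omega>)) \<partial>M)"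
    by (rule indep_vars_nn_integral[OF W ind']) simp
  also have "\<dots> = (\<Prod>j\<in>W. ennreal (p * s + (1 - p) / s))" by (intro prod.cong mean) auto
  also have "\<dots> = ennreal ((p * s + (1 - p) / s) ^ card W)"
    using s Q by (simp add: ennreal_power del: ennreal_plus)
  also have "\<dots> \<le> ennreal (sqrt Q ^ card W)"
    using s Q by (intro ennreal_leI power_mono) auto
  finally show ?thesis using Q by (simp add: emeasure_eq_measure)
qed

text \<open>When a sign \<open>X\<close> is added to \<open>S\<close>, independence removes the odd powers of \<open>X\<close>, so the fourth moment grows
  by \<open>6 E S\<^sup>2 + 1 = 6 m + 1\<close>, less than the growth \<open>6 m + 3\<close> of \<open>3 m\<^sup>2\<close>.\<close>

lemma (in prob_space) sum_of_signs_moments: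
  fixes X :: "'i \<Rightarrow> 'a \<Rightarrow> real"
  assumes "finite W" "indep_vars (\<lambda>_. borel) X W"
    and "\<And>j \<omega>. j \<in> W \<Longrightarrow> X j \<omega> = 1 \<or> X j \<omega> = - 1" and "\<And>j. j \<in> W \<Longrightarrow> expectation (X j) = 0"
  shows "expectation (\<lambda>\<omega>. (\<Sum>j\<in>W. X j \<omega>)\<^sup>2) = real (card W)
    \<and> expectation (\<lambda>\<omega>. (\<Sum>j\<in>W. X j \<omega>) ^ 4) \<le> 3 * (real (card W))\<^sup>2"
  using assms
proof (induction W rule: finite_induct)
  case (insert i W)
  define S where "S \<omega> = (\<Sum>j\<in>W. X j \<omega>)" for \<omega>
  have rv [measurable]: "j \<in> insert i W \<Longrightarrow> X j \<in> borel_measurable M" for j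
    using insert.prems(1) by (auto simp: indep_vars_def)
  have [measurable]: "X i \<in> borel_measurable M" "S \<in> borel_measurable M"
    unfolding S_def by (auto intro!: rv borel_measurable_sum)
  have X2: "(X i \<omega>)\<^sup>2 = 1" "\<bar>X i \<omega>\<bar> = 1" for \<omega> using insert.prems(2)[of i \<omega>] by auto
  have S_bound: "\<bar>S \<omega>\<bar> \<le> real (card W)" for \<omega>
  proof -
    have "\<bar>S \<omega>\<bar> \<le> (\<Sum>j\<in>W. \<bar>X j \<omega>\<bar>)" unfolding S_def by (rule sum_abs)
    also have "\<dots> = (\<Sum>j\<in>W. 1)" using insert.prems(2)[of _ \<omega>] by (intro sum.cong) fastforce+
    finally show ?thesis by simp
  qed
  have intS: "integrable M (\<lambda>\<omega>. (S \<omega>) ^ k)" for k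
    by (rule integrable_const_bound[of _ "real (card W) ^ k"])
       (auto simp: power_abs intro!: power_mono S_bound)
  have intX: "integrable M (X i)"
    by (rule integrable_const_bound[of _ 1]) (auto simp: X2)
  have "indep_var borel (X i) borel S"
    unfolding S_def by (rule indep_vars_sum) (use insert in auto)
  from indep_var_compose[OF this measurable_ident borel_measurable_power[OF measurable_ident]]
  have ind: "indep_var borel (X i) borel (\<lambda>\<omega>. S \<omega> ^ k)" for k
    by (simp add: comp_def id_def)
  have cross: "expectation (\<lambda>\<omega>. X i \<omega> * S \<omega> ^ k) = 0" "integrable M (\<lambda>\<omega>. X i \<omega> * S \<omega> ^ k)" for k
    using indep_var_lebesgue_integral[OF ind intX intS] indep_var_integrable[OF ind intX intS]
      insert.prems(3)[of i] by auto
  have IH: "expectation (\<lambda>\<omega>. (S \<omega>)\<^sup>2) = real (card W)"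
    "expectation (\<lambda>\<omega>. S \<omega> ^ 4) \<le> 3 * (real (card W))\<^sup>2"
    using insert.IH insert.prems indep_vars_subset[OF insert.prems(1), of W] by (auto simp: S_def)
  have sq: "(X i \<omega> + S \<omega>)\<^sup>2 = 1 + 2 * (X i \<omega> * S \<omega> ^ 1) + (S \<omega>)\<^sup>2" for \<omega>
    by (simp add: power2_sum X2)
  have X3: "X i \<omega> ^ 3 = X i \<omega>" "X i \<omega> ^ 4 = 1" for \<omega>
    using insert.prems(2)[of i \<omega>] by auto
  have four: "(X i \<omega> + S \<omega>) ^ 4 =
      1 + 4 * (X i \<omega> * S \<omega> ^ 1) + 6 * (S \<omega>)\<^sup>2 + 4 * (X i \<omega> * S \<omega> ^ 3) + S \<omega> ^ 4" for \<omega>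
  proof -
    have "(X i \<omega> + S \<omega>) ^ 4 = X i \<omega> ^ 4 + 4 * (X i \<omega> ^ 3 * S \<omega>) + 6 * ((X i \<omega>)\<^sup>2 * (S \<omega>)\<^sup>2)
        + 4 * (X i \<omega> * S \<omega> ^ 3) + S \<omega> ^ 4"
      by (simp add: eval_nat_numeral algebra_simps)
    then show ?thesis by (simp add: X2 X3)
  qed
  have "expectation (\<lambda>\<omega>. (X i \<omega> + S \<omega>)\<^sup>2) = 1 + expectation (\<lambda>\<omega>. (S \<omega>)\<^sup>2)"
    unfolding sq using cross[of 1] intS[of 2] by (simp add: prob_space)
  moreover have "expectation (\<lambda>\<omega>. (X i \<omega> + S \<omega>) ^ 4)
      = 1 + 6 * expectation (\<lambda>\<omega>. (S \<omega>)\<^sup>2) + expectation (\<lambda>\<omega>. S \<omega> ^ 4)"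
    unfolding four using cross[of 1] cross[of 3] intS[of 2] intS[of 4] by (simp add: prob_space)
  ultimately show ?case
    using IH insert.hyps by (auto simp: S_def power2_eq_square algebra_simps)
qed simp

text \<open>A Paley-Zygmund argument in pointwise form: with \<open>x = S\<^sup>2 / m\<close> the indicator of \<open>x > 1 / 4\<close> dominates a
  multiple of \<open>(x - 1 / 4) (5 - x)\<close>, whose mean is bounded below because \<open>E x = 1\<close> and
  \<open>E x\<^sup>2 \<le> 3\<close>.\<close>

lemma (in prob_space) sum_of_signs_anticoncentration:
  fixes X :: "'i \<Rightarrow> 'a \<Rightarrow> real"
  assumes W: "finite W" "W \<noteq> {}" and ind: "indep_vars (\<lambda>_. borel) X W"
    and pm: "\<And>j \<omega>. j \<in> W \<Longrightarrow> X j \<omega> = 1 \<or> X j \<omega> = - 1"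
    and zero: "\<And>j. j \<in> W \<Longrightarrow> expectation (X j) = 0"
  shows "1 / 6 \<le> prob {\<omega> \<in> space M. sqrt (card W) / 2 < \<bar>\<Sum>j\<in>W. X j \<omega>\<bar>}"
proof -
  define S m where "S \<omega> = (\<Sum>j\<in>W. X j \<omega>)" and "m = real (card W)" for \<omega>
  have m: "m > 0" using W by (simp add: m_def card_gt_0_iff)
  have [measurable]: "S \<in> borel_measurable M"
    unfolding S_def using ind by (auto intro!: borel_measurable_sum simp: indep_vars_def)
  have S_bound: "\<bar>S \<omega>\<bar> \<le> m" for \<omega>
  proof -
    have "\<bar>S \<omega>\<bar> \<le> (\<Sum>j\<in>W. \<bar>X j \<omega>\<bar>)" unfolding S_def by (rule sum_abs)
    also have "\<dots> = (\<Sum>j\<in>W. 1)" using pm[of _ \<omega>] by (intro sum.cong) fastforce+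
    finally show ?thesis by (simp add: m_def)
  qed
  have intS: "integrable M (\<lambda>\<omega>. (S \<omega>) ^ k)" for k
    by (rule integrable_const_bound[of _ "m ^ k"]) (auto simp: power_abs intro!: power_mono S_bound)
  let ?E = "{\<omega> \<in> space M. sqrt (card W) / 2 < \<bar>S \<omega>\<bar>}"
  \<comment> \<open>The factor \<open>64 / 361\<close> makes the maximum, attained at \<open>x = 21 / 8\<close>, equal to \<open>1\<close>.\<close>
  let ?q = "\<lambda>x::real. 16 / 361 * (21 / 4 * x - 5 / 4 - x\<^sup>2) * 4"
  have q: "?q x \<le> 1" "x \<le> 1 / 4 \<Longrightarrow> ?q x \<le> 0" for x
  proof -
    have "1 - ?q x = 64 / 361 * (x - 21 / 8)\<^sup>2" by (simp add: power2_eq_square field_simps)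
    then show "?q x \<le> 1" by (smt (verit) zero_le_power2 mult_nonneg_nonneg divide_nonneg_pos)
    assume "x \<le> 1 / 4"
    then have "(x - 1 / 4) * (5 - x) \<le> 0" by (intro mult_nonpos_nonneg) auto
    moreover have "21 / 4 * x - 5 / 4 - x\<^sup>2 = (x - 1 / 4) * (5 - x)"
      by (simp add: power2_eq_square field_simps)
    ultimately have e: "21 / 4 * x - 5 / 4 - x\<^sup>2 \<le> 0" by metis
    show "?q x \<le> 0" by (rule mult_nonpos_nonneg[OF mult_nonneg_nonpos[OF _ e]]) simp_all
  qed
  have "?q ((S \<omega>)\<^sup>2 / m) \<le> indicator ?E \<omega>" if "\<omega> \<in> space M" for \<omega>
  proof (cases "\<omega> \<in> ?E")
    case False
    then have "\<bar>S \<omega>\<bar> \<le> sqrt m / 2" using that by (simp add: m_def)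
    then have "\<bar>S \<omega>\<bar>\<^sup>2 \<le> (sqrt m / 2)\<^sup>2" by (intro power_mono) auto
    then have "(S \<omega>)\<^sup>2 / m \<le> 1 / 4" using m by (simp add: power_divide divide_le_eq)
    from q(2)[OF this] False show ?thesis by simp
  next
    case True
    show ?thesis unfolding indicator_simps(1)[OF True] by (rule q(1))
  qed
  moreover have "integrable M (indicator ?E :: 'a \<Rightarrow> real)"
    by (intro integrable_real_indicator) (auto simp: emeasure_eq_measure)
  ultimately have "expectation (\<lambda>\<omega>. ?q ((S \<omega>)\<^sup>2 / m)) \<le> expectation (indicator ?E)"
    using intS[of 2] intS[of 4]
    by (intro integral_mono) (simp_all add: power_divide flip: power_mult)
  moreover have "expectation (\<lambda>\<omega>. ?q ((S \<omega>)\<^sup>2 / m)) =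
      64 / 361 * (21 / 4 * (expectation (\<lambda>\<omega>. (S \<omega>)\<^sup>2) / m) - 5 / 4 - expectation (\<lambda>\<omega>. S \<omega> ^ 4) / m\<^sup>2)"
    using intS[of 2] intS[of 4] by (simp add: power_divide prob_space flip: power_mult)
  moreover have "expectation (\<lambda>\<omega>. (S \<omega>)\<^sup>2) / m = 1" "expectation (\<lambda>\<omega>. S \<omega> ^ 4) / m\<^sup>2 \<le> 3"
    using sum_of_signs_moments[OF W(1) ind pm zero] m unfolding S_def[symmetric] m_def[symmetric]
    by (auto simp: divide_le_eq)
  ultimately have "64 / 361 * (21 / 4 - 5 / 4 - 3) \<le> prob ?E" by simp
  then show ?thesis by (simp add: S_def)
qed

section \<open>Mean squared error of the median from above\<close>

text \<open>A real exponent is replaced by twice the natural number \<open>l\<close> with \<open>r / 4 \<le> l \<le> r / 2\<close>, and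
  Bernoulli's inequality is applied to the power \<open>l\<close>.\<close>

lemma powr_minus_le_inverse_square:
  fixes x r :: real
  assumes "0 < x" "2 \<le> r"
  shows "(1 + x) powr (- r) \<le> (4 / (r * x))\<^sup>2"
proof -
  define l where "l = nat \<lfloor>r / 2\<rfloor>"
  have l: "real l \<le> r / 2" "r / 4 \<le> real l" proof -
    have "1 \<le> \<lfloor>r / 2\<rfloor>" using assms by (simp add: le_floor_iff)
    then show "real l \<le> r / 2" "r / 4 \<le> real l" unfolding l_def by linarith+
  qed
  have "r * x / 4 \<le> 1 + real l * x" using mult_right_mono[OF l(2), of x] assms by linarith
  also have "\<dots> \<le> (1 + x) ^ l" using Bernoulli_inequality[of x l] assms by simp
  finally have "(r * x / 4)\<^sup>2 \<le> ((1 + x) ^ l)\<^sup>2" using assms by (intro power_mono) auto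
  also have "\<dots> = (1 + x) powr (2 * real l)"
    using assms by (simp add: powr_realpow[symmetric] powr_powr mult.commute flip: powr_numeral)
  also have "\<dots> \<le> (1 + x) powr r" using assms l by (intro powr_mono) auto
  finally have "(r * x / 4)\<^sup>2 \<le> (1 + x) powr r" .
  then have "inverse ((1 + x) powr r) \<le> inverse ((r * x / 4)\<^sup>2)" using assms by (intro le_imp_inverse_le) auto
  then show ?thesis using assms by (simp add: powr_minus power_divide divide_simps)
qed

locale noisy_grid = noise_law \<Psi> \<psi> for \<Psi> :: "real measure" and \<psi> :: "real \<Rightarrow> real" +
  fixes M :: "'a measure" and Z :: "nat \<Rightarrow> nat \<times> nat \<Rightarrow> 'a \<Rightarrow> real" and \<sigma> :: real
  assumes prob_M: "prob_space M" and noise: "\<And>n. white_noise M \<Psi> n (Z n)" and \<sigma>_pos: "\<sigma> > 0"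
begin

sublocale M: prob_space M by (rule prob_M)

lemma noise_indep: "W \<subseteq> grid n \<Longrightarrow> M.indep_vars (\<lambda>_. borel) (Z n) W"
  using noise[of n] M.indep_vars_subset unfolding white_noise_def by blast

lemma noise_measurable: "j \<in> grid n \<Longrightarrow> Z n j \<in> borel_measurable M"
  using noise_indep[of "grid n" n] by (auto simp: M.indep_vars_def)

lemma noise_prob:
  assumes j: "j \<in> grid n" and B: "B \<in> sets borel"
  shows "M.prob {\<omega> \<in> space M. Z n j \<omega> \<in> B} = prob B"
proof -
  have "prob B = measure (distr M borel (Z n j)) B"
    using noise[of n] j by (simp add: white_noise_def)
  also have "\<dots> = M.prob (Z n j -` B \<inter> space M)" by (rule measure_distr[OF noise_measurable[OF j] B])
  also have "Z n j -` B \<inter> space M = {\<omega> \<in> space M. Z n j \<omega> \<in> B}" by auto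
  finally show ?thesis by simp
qed

text \<open>The event that the noise alone could push the median of the pixels in \<open>W\<close> further than \<open>t\<close>. Written
  with counts it is measurable for simple reasons.\<close>

definition majority_beyond :: "nat \<Rightarrow> (nat \<times> nat) set \<Rightarrow> real \<Rightarrow> 'a set" where
  "majority_beyond n W t =
     {\<omega> \<in> space M. card W \<le> 2 * card {j \<in> W. Z n j \<omega> \<in> {t<..}}} \<union>
     {\<omega> \<in> space M. card W \<le> 2 * card {j \<in> W. Z n j \<omega> \<in> {..<- t}}}"

lemma majority_event:
  assumes W: "W \<subseteq> grid n" and B: "B \<in> sets borel"
  shows "{\<omega> \<in> space M. card W \<le> 2 * card {j \<in> W. Z n j \<omega> \<in> B}} \<in> M.events"
  by (rule sets_majority_hits) (use W B noise_measurable finite_subset[OF W] in auto)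

lemma majority_beyond_event: "W \<subseteq> grid n \<Longrightarrow> majority_beyond n W t \<in> M.events"
  unfolding majority_beyond_def by (intro sets.Un majority_event) auto

lemma majority_beyond_tail:
  obtains C m\<^sub>0 where "C > 0"
    "\<And>n W t. W \<subseteq> grid n \<Longrightarrow> m\<^sub>0 \<le> real (card W) \<Longrightarrow> 0 < card W \<Longrightarrow> 0 < t \<Longrightarrow>
       M.prob (majority_beyond n W t) \<le> (sqrt (C / real (card W)) / t) ^ 4"
proof -
  obtain b \<kappa> where b: "b > 0" "\<kappa> > 0" and
    q: "\<And>t. 0 \<le> t \<Longrightarrow> 4 * prob {t<..} * (1 - prob {t<..}) \<le> (1 + b * t\<^sup>2) powr (- \<kappa>)"
    by (rule tail_product_bound) blast
  define C where "C = 16 / (\<kappa> * b)"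
  have C: "C > 0" using b by (simp add: C_def)
  have "M.prob (majority_beyond n W t) \<le> (sqrt (C / real (card W)) / t) ^ 4"
    if W: "W \<subseteq> grid n" and m: "4 / \<kappa> \<le> real (card W)" "0 < card W" and t: "0 < t" for n W t
  proof -
    let ?m = "real (card W)"
    define Q where "Q = (1 + b * t\<^sup>2) powr (- \<kappa>)"
    have base: "1 \<le> 1 + b * t\<^sup>2" using b by simp
    have Q: "0 < Q" "Q \<le> 1"
      using powr_mono[of "- \<kappa>" 0 "1 + b * t\<^sup>2"] b base unfolding Q_def by (simp_all, linarith)
    have half: "prob {t<..} \<le> 1 / 2"
      using finite_measure_mono[of "{t<..}" "{0<..}"] t by (simp add: prob_positive)
    have finW: "finite W" using finite_subset[OF W] by simp
    have "sqrt Q ^ card W = Q powr (?m / 2)"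
      using Q by (simp add: powr_half_sqrt[symmetric] powr_powr powr_realpow[symmetric])
    also have "\<dots> = (1 + b * t\<^sup>2) powr (- (\<kappa> * ?m / 2))" by (simp add: Q_def powr_powr)
    also have "\<dots> \<le> (4 / (\<kappa> * ?m / 2 * (b * t\<^sup>2)))\<^sup>2"
      using b t m by (intro powr_minus_le_inverse_square) (auto simp: field_simps)
    finally have SQ: "sqrt Q ^ card W \<le> (8 / (\<kappa> * ?m * (b * t\<^sup>2)))\<^sup>2" by (simp add: field_simps)
    have side: "M.prob {\<omega> \<in> space M. card W \<le> 2 * card {j \<in> W. Z n j \<omega> \<in> B}}
        \<le> (8 / (\<kappa> * ?m * (b * t\<^sup>2)))\<^sup>2" if B: "B \<in> sets borel" "prob B = prob {t<..}" for B
    proof -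
      have "M.prob {\<omega> \<in> space M. card W \<le> 2 * card {j \<in> W. Z n j \<omega> \<in> B}} \<le> sqrt Q ^ card W"
      proof (rule M.majority_chernoff[OF finW noise_indep[OF W] B(1)])
        show "M.prob {\<omega> \<in> space M. Z n j \<omega> \<in> B} = prob {t<..}" if "j \<in> W" for j
          using noise_prob[of j n B] B W that by auto
        show "4 * prob {t<..} * (1 - prob {t<..}) \<le> Q" unfolding Q_def using t by (intro q) simp
      qed (use half Q in auto)
      then show ?thesis using SQ by linarith
    qed
    have "M.prob (majority_beyond n W t) \<le> (8 / (\<kappa> * ?m * (b * t\<^sup>2)))\<^sup>2 + (8 / (\<kappa> * ?m * (b * t\<^sup>2)))\<^sup>2"
      unfolding majority_beyond_def
      by (rule order_trans[OF measure_Un_le add_mono])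
         (intro majority_event[OF W] side; simp add: prob_lessThan_minus)+
    also have "\<dots> = 128 / (\<kappa> * ?m * b)\<^sup>2 / t ^ 4"
      by (simp add: power_divide power_mult_distrib eval_nat_numeral)
    also have "\<dots> \<le> 256 / (\<kappa> * ?m * b)\<^sup>2 / t ^ 4" by (intro divide_right_mono) auto
    also have "\<dots> = (C / ?m)\<^sup>2 / t ^ 4" by (simp add: C_def power_divide power_mult_distrib)
    also have "(C / ?m)\<^sup>2 = ((sqrt (C / ?m))\<^sup>2)\<^sup>2" using C by simp
    also have "\<dots> = sqrt (C / ?m) ^ 4" by (simp flip: power_mult)
    finally show ?thesis by (simp add: power_divide)
  qed
  then show thesis using that C by blast
qed

text \<open>If the signal varies by at most \<open>b\<close> on the window and the median errs by more than
  \<open>b + \<sigma> t\<close>, then at least half of the noise variables lie beyond \<open>t\<close> on one side. Hence the excess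
  \<open>g\<close> over \<open>b\<close>, in units of \<open>\<sigma>\<close>, has a quartic tail.\<close>

lemma median_mse_upper:
  obtains C m\<^sub>0 where "C > 0"
    "\<And>n h i f b. n > 0 \<Longrightarrow> m\<^sub>0 \<le> real (card (window n h i)) \<Longrightarrow> 0 < card (window n h i) \<Longrightarrow> 0 \<le> b \<Longrightarrow>
       (\<And>j. j \<in> window n h i \<Longrightarrow> \<bar>f (grid_point n j) - f (grid_point n i)\<bar> \<le> b) \<Longrightarrow>
       (\<integral>\<^sup>+\<omega>. ennreal ((median_filter n h (observe n \<sigma> (Z n) f \<omega>) i - f (grid_point n i))\<^sup>2) \<partial>M)
         \<le> ennreal (2 * b\<^sup>2 + C / real (card (window n h i)))"
proof -
  obtain C m\<^sub>0 where C: "C > 0" and tail: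
    "\<And>n W t. W \<subseteq> grid n \<Longrightarrow> m\<^sub>0 \<le> real (card W) \<Longrightarrow> 0 < card W \<Longrightarrow> 0 < t \<Longrightarrow>
       M.prob (majority_beyond n W t) \<le> (sqrt (C / real (card W)) / t) ^ 4"
    by (rule majority_beyond_tail) blast
  have "(\<integral>\<^sup>+\<omega>. ennreal ((median_filter n h (observe n \<sigma> (Z n) f \<omega>) i - f (grid_point n i))\<^sup>2) \<partial>M)
         \<le> ennreal (2 * b\<^sup>2 + 14 * \<sigma>\<^sup>2 * C / real (card (window n h i)))"
    if n: "n > 0" and m: "m\<^sub>0 \<le> real (card (window n h i))" "0 < card (window n h i)" and b: "0 \<le> b"
      and f: "\<And>j. j \<in> window n h i \<Longrightarrow> \<bar>f (grid_point n j) - f (grid_point n i)\<bar> \<le> b"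
    for n h i f b
  proof -
    define W where "W = window n h i"
    define c where "c = f (grid_point n i)"
    define Y where "Y = observe n \<sigma> (Z n) f"
    define err where "err \<omega> = \<bar>median_filter n h (Y \<omega>) i - c\<bar>" for \<omega>
    define g where "g \<omega> = max 0 ((err \<omega> - b) / \<sigma>)" for \<omega>
    have W: "W \<subseteq> grid n" "W \<noteq> {}" "finite W" using m by (auto simp: W_def window_subset_grid[THEN subsetD])
    have Yj: "\<bar>Y \<omega> j - c - \<sigma> * Z n j \<omega>\<bar> \<le> b" if "j \<in> W" for j \<omega>
      using f[of j] that by (simp add: Y_def observe_def c_def W_def)
    have sub: "\<omega> \<in> majority_beyond n W t" if \<omega>: "\<omega> \<in> space M" and t: "0 < t" "t < g \<omega>" for \<omega> t
    proof -
      have big: "b + \<sigma> * t < err \<omega>" using t \<sigma>_pos by (simp add: g_def pos_less_divide_eq max_def mult.commute split: if_splits)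
      consider "median_filter n h (Y \<omega>) i > c + b + \<sigma> * t" | "median_filter n h (Y \<omega>) i < c - b - \<sigma> * t"
        using big by (auto simp: err_def abs_if split: if_splits)
      then show ?thesis
      proof cases
        case 1
        then have "card W \<le> 2 * card {j \<in> W. Y \<omega> j > c + b + \<sigma> * t}"
          using median_le[OF W_def W(2), where Y = "Y \<omega>" and t = "c + b + \<sigma> * t"] by linarith
        also have "{j \<in> W. Y \<omega> j > c + b + \<sigma> * t} \<subseteq> {j \<in> W. Z n j \<omega> \<in> {t<..}}"
        proof (intro subsetI CollectI conjI)
          fix j assume j: "j \<in> {j \<in> W. Y \<omega> j > c + b + \<sigma> * t}"
          then show "j \<in> W" by simp
          then have "\<sigma> * t < \<sigma> * Z n j \<omega>" using Yj[of j \<omega>] j by auto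
          then show "Z n j \<omega> \<in> {t<..}" using \<sigma>_pos by simp
        qed
        then have "card {j \<in> W. Y \<omega> j > c + b + \<sigma> * t} \<le> card {j \<in> W. Z n j \<omega> \<in> {t<..}}"
          using W by (intro card_mono) auto
        finally show ?thesis using \<omega> by (simp add: majority_beyond_def)
      next
        case 2
        then have "card W \<le> 2 * card {j \<in> W. Y \<omega> j < c - b - \<sigma> * t}"
          using median_ge[OF W_def W(2), where Y = "Y \<omega>" and t = "c - b - \<sigma> * t"] by linarith
        also have "{j \<in> W. Y \<omega> j < c - b - \<sigma> * t} \<subseteq> {j \<in> W. Z n j \<omega> \<in> {..<- t}}"
        proof (intro subsetI CollectI conjI)
          fix j assume j: "j \<in> {j \<in> W. Y \<omega> j < c - b - \<sigma> * t}"
          then show "j \<in> W" by simp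
          then have "\<sigma> * Z n j \<omega> < \<sigma> * (- t)" using Yj[of j \<omega>] j by auto
          then show "Z n j \<omega> \<in> {..<- t}" using \<sigma>_pos by (simp only: mult_less_cancel_left_pos lessThan_iff)
        qed
        then have "card {j \<in> W. Y \<omega> j < c - b - \<sigma> * t} \<le> card {j \<in> W. Z n j \<omega> \<in> {..<- t}}"
          using W by (intro card_mono) auto
        finally show ?thesis using \<omega> by (simp add: majority_beyond_def)
      qed
    qed
    have sq: "(err \<omega>)\<^sup>2 \<le> 2 * b\<^sup>2 + 2 * \<sigma>\<^sup>2 * (g \<omega>)\<^sup>2" for \<omega>
    proof -
      have "err \<omega> \<le> b + \<sigma> * g \<omega>" 
        using \<sigma>_pos by (auto simp: g_def max_def zero_le_divide_iff)
      moreover have "0 \<le> err \<omega>" by (simp add: err_def)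
      ultimately have "(err \<omega>)\<^sup>2 \<le> (b + \<sigma> * g \<omega>)\<^sup>2" by (intro power_mono)
      also have "\<dots> \<le> 2 * b\<^sup>2 + 2 * (\<sigma> * g \<omega>)\<^sup>2"
        using zero_le_power2[of "b - \<sigma> * g \<omega>"] by (simp add: power2_sum power2_diff)
      finally show ?thesis by (simp add: power_mult_distrib)
    qed
    have "(\<integral>\<^sup>+\<omega>. ennreal ((err \<omega>)\<^sup>2) \<partial>M) \<le> (\<integral>\<^sup>+\<omega>. ennreal (2 * b\<^sup>2 + 2 * \<sigma>\<^sup>2 * (g \<omega>)\<^sup>2) \<partial>M)"
      by (intro nn_integral_mono ennreal_leI sq)
    also have "\<dots> \<le> ennreal (2 * b\<^sup>2 + 2 * \<sigma>\<^sup>2 * (7 * (sqrt (C / real (card W)))\<^sup>2))"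
      by (rule M.second_moment_of_quartic_tail[where A = "majority_beyond n W"])
         (use W m C sub tail majority_beyond_event in \<open>auto simp: g_def W_def\<close>)
    also have "\<dots> = ennreal (2 * b\<^sup>2 + 14 * \<sigma>\<^sup>2 * C / real (card W))" using C by simp
    finally show ?thesis by (simp add: err_def c_def Y_def W_def)
  qed
  moreover have "14 * \<sigma>\<^sup>2 * C > 0" using C \<sigma>_pos by simp
  ultimately show thesis by (intro that[of "14 * \<sigma>\<^sup>2 * C" m\<^sub>0]) blast+
qed

end

section \<open>Upper bound on the risk\<close>

lemma convex_unit_square: "convex unit_square"
  unfolding unit_square_def by (intro convex_Times convex_real_interval)

text \<open>For this bandwidth \<open>(n h)\<^sup>2 = 1 / h\<close>, so the variance term is of the same order \<open>h\<close> as the proportion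
  of pixels close to a curve. A pixel outside the tube \<open>B\<close> sees a disc without curves, on which \<open>f\<close> has
  Lipschitz constant \<open>2 \<beta>\<close>; on the tube \<open>0 \<le> f \<le> 1\<close> is enough.\<close>

lemma (in noisy_grid) class_risk_upper:
  assumes L: "L > 0" and \<beta>: "\<beta> > 0"
  shows "\<exists>C. \<forall>\<^sub>F n in sequentially.
    class_risk M n \<sigma> (Z n) (median_filter n (real n powr (- 2 / 3))) (CPLIP L \<beta> N)
      \<le> ennreal (C * real n powr (- 2 / 3))"
proof -
  obtain C m\<^sub>0 where C: "C > 0" and mse:
    "\<And>n h i f b. n > 0 \<Longrightarrow> m\<^sub>0 \<le> real (card (window n h i)) \<Longrightarrow> 0 < card (window n h i) \<Longrightarrow> 0 \<le> b \<Longrightarrow>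
       (\<And>j. j \<in> window n h i \<Longrightarrow> \<bar>f (grid_point n j) - f (grid_point n i)\<bar> \<le> b) \<Longrightarrow>
       (\<integral>\<^sup>+\<omega>. ennreal ((median_filter n h (observe n \<sigma> (Z n) f \<omega>) i - f (grid_point n i))\<^sup>2) \<partial>M)
         \<le> ennreal (2 * b\<^sup>2 + C / real (card (window n h i)))"
    by (rule median_mse_upper) blast
  define C' where "C' = 8 * \<beta>\<^sup>2 + 4 * C + 50 * real N * (L + 1)"
  have "filterlim (\<lambda>n. real n powr (2 / 3) / 4) at_top sequentially" by real_asymp
  then have "\<forall>\<^sub>F n in sequentially. m\<^sub>0 \<le> real n powr (2 / 3) / 4"
    by (simp add: filterlim_at_top)
  then have "\<forall>\<^sub>F n in sequentially.
    class_risk M n \<sigma> (Z n) (median_filter n (real n powr (- 2 / 3))) (CPLIP L \<beta> N)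
      \<le> ennreal (C' * real n powr (- 2 / 3))"
    using eventually_gt_at_top[of 0]
  proof eventually_elim
    case (elim n)
    define h where "h = real n powr (- 2 / 3)"
    have n: "real n \<ge> 1" "n > 0" using elim by auto
    have h: "0 < h" "h \<le> 1"
      using n powr_mono[of "- 2 / 3" 0 "real n"] by (auto simp: h_def)
    have nh1: "real n * h = real n powr (1 / 3)"
      unfolding h_def using powr_add[of "real n" 1 "- 2 / 3"] n by simp
    have nh: "1 \<le> real n * h" unfolding nh1 using n by (simp add: ge_one_powr_ge_zero)
    have nh2: "(real n * h)\<^sup>2 = real n powr (2 / 3)"
      unfolding nh1 using n by (simp add: powr_powr flip: powr_numeral)
    have "h = inverse (real n powr (2 / 3))" by (simp add: h_def flip: powr_minus)
    then have nh3: "(real n * h)\<^sup>2 * h = 1" unfolding nh2 using n by simp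
    have "risk M n \<sigma> (Z n) (median_filter n h) f \<le> ennreal (C' * h)" if f: "f \<in> CPLIP L \<beta> N" for f
    proof -
      obtain K where K: "K \<in> complexes N L" and f01: "f ` unit_square \<subseteq> {0..1}"
        and lip: "\<And>x. x \<in> unit_square \<Longrightarrow> x \<notin> (\<Union>g\<in>K. path_image g) \<Longrightarrow> local_Lip f x \<le> ereal \<beta>"
        using f unfolding CPLIP_def by blast
      define B where "B = {i \<in> grid n. \<exists>g\<in>K. \<exists>z\<in>path_image g. dist (grid_point n i) z \<le> h}"
      have B: "B \<subseteq> grid n" "finite B" by (auto simp: B_def)
      let ?e = "\<lambda>i. (8 * \<beta>\<^sup>2 + 4 * C) * h + (if i \<in> B then 2 else 0)"
      have pixel: "(\<integral>\<^sup>+\<omega>. ennreal ((median_filter n h (observe n \<sigma> (Z n) f \<omega>) i - f (grid_point n i))\<^sup>2) \<partial>M)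
          \<le> ennreal (?e i)" if i: "i \<in> grid n" for i
      proof -
        let ?m = "real (card (window n h i))"
        have m: "(real n * h)\<^sup>2 / 4 \<le> ?m" using card_window_ge[OF i] h by simp
        have mpos: "0 < ?m" using m nh by (smt (verit) divide_pos_pos one_le_power)
        have "C * (4 * ((real n * h)\<^sup>2 * h)) / 4 \<le> C * (4 * h * ?m)"
          using mult_left_mono[OF m, of "4 * C * h"] C h by (simp add: mult_ac)
        then have "C \<le> 4 * C * h * ?m" unfolding nh3 by simp
        then have Cm: "C / ?m \<le> 4 * C * h" using mpos by (simp add: divide_le_eq)
        define b where "b = (if i \<in> B then 1 else 2 * \<beta> * h)"
        have "(\<integral>\<^sup>+\<omega>. ennreal ((median_filter n h (observe n \<sigma> (Z n) f \<omega>) i - f (grid_point n i))\<^sup>2) \<partial>M)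
          \<le> ennreal (2 * b\<^sup>2 + C / ?m)"
        proof (rule mse)
          show "n > 0" "0 < card (window n h i)" "0 \<le> b" using n mpos \<beta> h by (auto simp: b_def)
          show "m\<^sub>0 \<le> ?m" using elim m unfolding nh2 by linarith
          fix j assume j: "j \<in> window n h i"
          have sq: "grid_point n i \<in> unit_square" "grid_point n j \<in> unit_square"
            using i j window_subset_grid grid_point_in_unit_square by blast+
          have d: "dist (grid_point n i) (grid_point n j) \<le> h"
            using window_dist[OF j n(2)] by (simp add: dist_commute)
          show "\<bar>f (grid_point n j) - f (grid_point n i)\<bar> \<le> b"
          proof (cases "i \<in> B")
            case True
            have "f (grid_point n i) \<in> {0..1}" "f (grid_point n j) \<in> {0..1}" using f01 sq by blast+
            then show ?thesis using True by (auto simp: b_def)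
          next
            case False
            have "\<bar>f (grid_point n j) - f (grid_point n i)\<bar> \<le> (2 * \<beta>) * dist (grid_point n i) (grid_point n j)"
            proof (rule local_Lip_segment)
              fix z assume z: "z \<in> closed_segment (grid_point n i) (grid_point n j)"
              have zs: "z \<in> unit_square"
                using z closed_segment_subset[OF sq convex_unit_square] by blast
              have "dist (grid_point n i) z \<le> h"
                using dist_in_closed_segment[OF z] d by (simp add: dist_commute)
              then have "z \<notin> (\<Union>g\<in>K. path_image g)" using False i by (auto simp: B_def)
              then show "z \<in> unit_square \<and> local_Lip f z \<le> ereal \<beta>" using zs lip by blast
            qed (use \<beta> in auto)
            also have "\<dots> \<le> 2 * \<beta> * h" using d \<beta> by simp
            finally show ?thesis using False by (simp add: b_def)
          qed
        qed
        also have "\<dots> \<le> ennreal (?e i)"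
        proof (rule ennreal_leI)
          have "\<beta>\<^sup>2 * h\<^sup>2 \<le> \<beta>\<^sup>2 * h"
            using h by (intro mult_left_mono) (auto simp: power2_eq_square mult_left_le)
          moreover have "0 \<le> \<beta>\<^sup>2 * h" using h by simp
          ultimately have "2 * b\<^sup>2 \<le> 8 * (\<beta>\<^sup>2 * h) + (if i \<in> B then 2 else 0)"
            by (simp add: b_def power_mult_distrib)
          then show "2 * b\<^sup>2 + C / ?m \<le> ?e i" using Cm by (simp add: algebra_simps)
        qed
        finally show ?thesis .
      qed
      have cardB: "real (card B) \<le> 25 * real N * (L + 1) * h * (real n)\<^sup>2"
      proof -
        have "real (card B) \<le> real N * (L / h + 1) * (4 * (real n * h) + 1)\<^sup>2"
          unfolding B_def by (rule card_tube[OF K n(2) h(1)]) (use L in simp)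
        also have "\<dots> \<le> real N * ((L + 1) / h) * (5 * (real n * h))\<^sup>2"
        proof (intro mult_mono power_mono)
          show "L / h + 1 \<le> (L + 1) / h" using h by (simp add: add_divide_distrib)
        qed (use L h nh in \<open>auto simp: mult.commute\<close>)
        also have "\<dots> = 25 * real N * (L + 1) * h * (real n)\<^sup>2"
          using h by (simp add: power_mult_distrib power2_eq_square)
        finally show ?thesis .
      qed
      have "(\<Sum>i\<in>grid n. \<integral>\<^sup>+\<omega>. ennreal ((median_filter n h (observe n \<sigma> (Z n) f \<omega>) i - f (grid_point n i))\<^sup>2) \<partial>M)
          \<le> (\<Sum>i\<in>grid n. ennreal (?e i))"
        by (intro sum_mono pixel)
      also have "\<dots> = ennreal (\<Sum>i\<in>grid n. ?e i)" using C h by (intro sum_ennreal) auto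
      also have "(\<Sum>i\<in>grid n. ?e i) = (real n)\<^sup>2 * ((8 * \<beta>\<^sup>2 + 4 * C) * h) + 2 * real (card B)"
        using B by (simp add: sum.distrib card_grid sum.If_cases Int_absorb1 power2_eq_square)
      also have "\<dots> \<le> (real n)\<^sup>2 * (C' * h)"
        using cardB by (simp add: C'_def algebra_simps)
      finally have "risk M n \<sigma> (Z n) (median_filter n h) f
          \<le> ennreal (1 / (real n)\<^sup>2) * ennreal ((real n)\<^sup>2 * (C' * h))"
        unfolding risk_def by (intro mult_left_mono) (auto intro: ennreal_leI)
      also have "\<dots> = ennreal (C' * h)"
        using n by (simp add: ennreal_mult'[symmetric])
      finally show ?thesis .
    qed
    then show ?case unfolding class_risk_def h_def by (intro SUP_least)
  qed
  then show ?thesis by blast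
qed

section \<open>Mean squared error of the median from below\<close>

lemma (in prob_space) nn_integral_square_ge:
  assumes A: "A \<in> events" and r: "0 \<le> r" "r \<le> prob A" and a: "0 \<le> a"
    and g: "\<And>\<omega>. \<omega> \<in> A \<Longrightarrow> a \<le> \<bar>g \<omega>\<bar>"
  shows "ennreal (a\<^sup>2 * r) \<le> (\<integral>\<^sup>+\<omega>. ennreal ((g \<omega>)\<^sup>2) \<partial>M)"
proof -
  have "ennreal (a\<^sup>2 * r) \<le> ennreal (a\<^sup>2) * emeasure M A"
    using r by (simp add: emeasure_eq_measure ennreal_mult mult_left_mono ennreal_leI)
  also have "\<dots> = (\<integral>\<^sup>+\<omega>. ennreal (a\<^sup>2) * indicator A \<omega> \<partial>M)"
    using A by (simp add: nn_integral_cmult_indicator)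
  also have "\<dots> \<le> (\<integral>\<^sup>+\<omega>. ennreal ((g \<omega>)\<^sup>2) \<partial>M)"
  proof (rule nn_integral_mono)
    fix \<omega>
    show "ennreal (a\<^sup>2) * indicator A \<omega> \<le> ennreal ((g \<omega>)\<^sup>2)"
    proof (cases "\<omega> \<in> A")
      case True
      have "a\<^sup>2 \<le> \<bar>g \<omega>\<bar>\<^sup>2" using g[OF True] a by (intro power_mono) auto
      then show ?thesis using True by (simp add: ennreal_leI)
    qed simp
  qed
  finally show ?thesis .
qed

lemma risk_ge:
  assumes P: "P \<subseteq> grid n" and c: "0 \<le> c"
    and pixel: "\<And>i. i \<in> P \<Longrightarrow>
      ennreal c \<le> (\<integral>\<^sup>+\<omega>. ennreal ((T (observe n \<sigma> Z f \<omega>) i - f (grid_point n i))\<^sup>2) \<partial>M)"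
  shows "ennreal (real (card P) * c / (real n)\<^sup>2) \<le> risk M n \<sigma> Z T f"
proof -
  have "ennreal (real (card P) * c) = (\<Sum>i\<in>P. ennreal c)"
    using c by (simp add: ennreal_of_nat_eq_real_of_nat ennreal_mult)
  also have "\<dots> \<le> (\<Sum>i\<in>P. \<integral>\<^sup>+\<omega>. ennreal ((T (observe n \<sigma> Z f \<omega>) i - f (grid_point n i))\<^sup>2) \<partial>M)"
    by (intro sum_mono pixel)
  also have "\<dots> \<le> (\<Sum>i\<in>grid n. \<integral>\<^sup>+\<omega>. ennreal ((T (observe n \<sigma> Z f \<omega>) i - f (grid_point n i))\<^sup>2) \<partial>M)"
    by (intro sum_mono2 P) auto
  finally have "ennreal (1 / (real n)\<^sup>2) * ennreal (real (card P) * c) \<le> risk M n \<sigma> Z T f"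
    unfolding risk_def by (intro mult_left_mono) auto
  then show ?thesis using c by (simp add: ennreal_mult[symmetric])
qed

context noisy_grid
begin

text \<open>Let \<open>D\<close> of the noise variables lie in \<open>[-u, u]\<close>, and let \<open>S\<close> be the sum of the signs. If
  \<open>\<bar>S\<bar> > 2 D\<close>, a strict majority lies beyond \<open>u\<close> on one side and so does the median. At the scale
  \<open>u = a / sqrt m\<close> the mean of \<open>D\<close> is at most \<open>B * a * sqrt m\<close>, a small multiple of the typical size
  \<open>sqrt m\<close> of \<open>\<bar>S\<bar>\<close>.\<close>

lemma median_variance_lower:
  obtains c where "c > 0"
    "\<And>n h i. i \<in> grid n \<Longrightarrow> 0 < h \<Longrightarrow>
      ennreal (c / real (card (window n h i)))
        \<le> (\<integral>\<^sup>+\<omega>. ennreal ((median_filter n h (observe n \<sigma> (Z n) (\<lambda>_. 0) \<omega>) i - 0)\<^sup>2) \<partial>M)"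
proof -
  obtain B where B: "B > 0" and near: "\<And>u. u \<ge> 0 \<Longrightarrow> prob {-u..u} \<le> B * u" by (rule prob_near_zero) blast
  \<comment> \<open>With this \<open>a\<close>, Markov's inequality gives \<open>P (D \<ge> sqrt m / 4) \<le> 1 / 12\<close>, half of the bound \<open>1 / 6\<close> for \<open>\<bar>S\<bar>\<close>.\<close>
  define a where "a = 1 / (48 * B)"
  have a: "a > 0" using B by (simp add: a_def)
  have "ennreal ((\<sigma> * a)\<^sup>2 / 12 / real (card (window n h i)))
        \<le> (\<integral>\<^sup>+\<omega>. ennreal ((median_filter n h (observe n \<sigma> (Z n) (\<lambda>_. 0) \<omega>) i - 0)\<^sup>2) \<partial>M)"
    if i: "i \<in> grid n" and h: "0 < h" for n h i
  proof -
    define W m where "W = window n h i" and "m = real (card W)"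
    define Y where "Y = observe n \<sigma> (Z n) (\<lambda>_. 0)"
    have W: "W \<subseteq> grid n" "W \<noteq> {}" "finite W"
      using self_in_window[OF i, of h] h window_subset_grid by (auto simp: W_def)
    have m: "m > 0" using W by (simp add: m_def card_gt_0_iff)
    define u where "u = a / sqrt m"
    have u: "u > 0" using a m by (simp add: u_def)
    have Z_meas: "Z n j \<in> borel_measurable M" if "j \<in> W" for j using that W(1) noise_measurable by blast
    have Z_prob: "M.prob {\<omega> \<in> space M. Z n j \<omega> \<in> B} = prob B" if "j \<in> W" "B \<in> sets borel" for j B
      using that W(1) noise_prob by blast
    define X where "X j \<omega> = (if Z n j \<omega> \<in> {0<..} then 1 else - 1 :: real)" for j \<omega>
    have X_eq: "X = (\<lambda>j \<omega>. (\<lambda>x. if x \<in> {0<..} then 1 else - 1) (Z n j \<omega>))"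
      by (intro ext) (simp add: X_def)
    have X_meas: "X j \<in> borel_measurable M" if "j \<in> W" for j
      unfolding X_eq by (rule measurable_compose[OF Z_meas[OF that]]) measurable
    have X_ind: "M.indep_vars (\<lambda>_. borel) X W"
      unfolding X_eq by (rule M.indep_vars_compose2[OF noise_indep[OF W(1)]]) measurable
    have X_mean: "M.expectation (X j) = 0" if j: "j \<in> W" for j
    proof -
      let ?E = "{\<omega> \<in> space M. Z n j \<omega> \<in> {0<..}}"
      have E: "?E \<in> M.events" using measurable_sets[OF Z_meas[OF j], of "{0<..}"] by (simp add: vimage_def Int_def conj_commute)
      have "M.expectation (X j) = M.expectation (\<lambda>\<omega>. 2 * indicator ?E \<omega> - 1)"
        by (intro Bochner_Integration.integral_cong) (auto simp: X_def)
      also have "\<dots> = 2 * M.prob ?E - 1"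
        using E by (subst Bochner_Integration.integral_diff) (auto simp: M.prob_space M.emeasure_eq_measure)
      also have "M.prob ?E = 1 / 2"
        using noise_prob[of j n "{0<..}"] j W prob_positive by auto
      finally show ?thesis by simp
    qed
    define S where "S \<omega> = (\<Sum>j\<in>W. X j \<omega>)" for \<omega>
    define D where "D \<omega> = real (card {j \<in> W. Z n j \<omega> \<in> {-u..u}})" for \<omega>
    have [measurable]: "S \<in> borel_measurable M"
      unfolding S_def by (intro borel_measurable_sum X_meas)
    have [measurable]: "D \<in> borel_measurable M"
      unfolding D_def by (rule borel_measurable_card_hits[OF W(3) Z_meas]) auto
    let ?E = "{\<omega> \<in> space M. sqrt m / 2 < \<bar>S \<omega>\<bar>}" and ?F = "{\<omega> \<in> space M. sqrt m / 4 \<le> D \<omega>}"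
    have PE: "1 / 6 \<le> M.prob ?E"
      unfolding S_def m_def
      by (rule M.sum_of_signs_anticoncentration[OF W(3,2) X_ind _ X_mean]) (auto simp: X_def)
    have "M.prob ?F \<le> real (card W) * prob {-u..u} / (sqrt m / 4)"
      unfolding D_def
      by (rule M.prob_many_hits_le[OF W(3) Z_meas _ Z_prob]) (use m in auto)
    also have "\<dots> \<le> m * (B * u) / (sqrt m / 4)"
      using near[of u] u m by (intro divide_right_mono mult_left_mono) (auto simp: m_def)
    also have "\<dots> = 1 / 12"
      using m B by (simp add: u_def a_def field_simps flip: real_sqrt_mult)
    finally have PF: "M.prob ?F \<le> 1 / 12" .
    have "M.prob ?E \<le> M.prob ((?E - ?F) \<union> ?F)" by (intro M.finite_measure_mono) auto
    also have "\<dots> \<le> M.prob (?E - ?F) + M.prob ?F" by (intro measure_Un_le) auto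
    finally have PA: "1 / 12 \<le> M.prob (?E - ?F)" using PE PF by linarith
    have far: "\<sigma> * u \<le> \<bar>median_filter n h (Y \<omega>) i - 0\<bar>" if \<omega>: "\<omega> \<in> ?E - ?F" for \<omega>
    proof -
      define P Q where "P = {j \<in> W. Z n j \<omega> > u}" and "Q = {j \<in> W. Z n j \<omega> < - u}"
      define R where "R = {j \<in> W. Z n j \<omega> \<in> {-u..u}}"
      have fin: "finite P" "finite Q" "finite R" using W by (auto simp: P_def Q_def R_def)
      have part: "W = P \<union> Q \<union> R" "P \<inter> Q = {}" "(P \<union> Q) \<inter> R = {}"
        using u by (auto simp: P_def Q_def R_def)
      have cards: "real (card W) = real (card P) + real (card Q) + real (card R)"
        using card_Un_disjoint[of "P \<union> Q" R] card_Un_disjoint[of P Q] fin part by simp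
      have "S \<omega> = (\<Sum>j\<in>P. X j \<omega>) + (\<Sum>j\<in>Q. X j \<omega>) + (\<Sum>j\<in>R. X j \<omega>)"
        unfolding S_def part(1) using fin part(2,3) by (simp add: sum.union_disjoint)
      also have "(\<Sum>j\<in>P. X j \<omega>) = (\<Sum>j\<in>P. 1)" using u by (intro sum.cong) (auto simp: P_def X_def)
      also have "(\<Sum>j\<in>Q. X j \<omega>) = (\<Sum>j\<in>Q. - 1)" using u by (intro sum.cong) (auto simp: Q_def X_def)
      finally have S: "S \<omega> = real (card P) - real (card Q) + (\<Sum>j\<in>R. X j \<omega>)" by simp
      have "\<bar>\<Sum>j\<in>R. X j \<omega>\<bar> \<le> (\<Sum>j\<in>R. \<bar>X j \<omega>\<bar>)" by (rule sum_abs)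
      also have "\<dots> \<le> (\<Sum>j\<in>R. 1)" by (intro sum_mono) (auto simp: X_def)
      finally have R: "\<bar>\<Sum>j\<in>R. X j \<omega>\<bar> \<le> real (card R)" by simp
      have "2 * real (card R) < \<bar>S \<omega>\<bar>" using \<omega> by (auto simp: D_def R_def)
      then consider "real (card W) < 2 * real (card P)" | "real (card W) < 2 * real (card Q)"
        using S R cards by linarith
      then show ?thesis
      proof cases
        case 1
        have "P = {j \<in> W. Y \<omega> j > \<sigma> * u}" using \<sigma>_pos by (auto simp: P_def Y_def observe_def)
        moreover have "card W < 2 * card P" using 1 by linarith
        ultimately have "median_filter n h (Y \<omega>) i > \<sigma> * u"
          using median_gt[OF W_def W(2), where Y = "Y \<omega>" and t = "\<sigma> * u"] by simp
        then show ?thesis by linarith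
      next
        case 2
        have "\<sigma> * x < - (\<sigma> * u) \<longleftrightarrow> x < - u" for x
          using mult_less_cancel_left_pos[OF \<sigma>_pos, of x "- u"] by simp
        then have "Q = {j \<in> W. Y \<omega> j < - (\<sigma> * u)}" by (auto simp: Q_def Y_def observe_def)
        moreover have "card W < 2 * card Q" using 2 by linarith
        ultimately have "median_filter n h (Y \<omega>) i < - (\<sigma> * u)"
          using median_lt[OF W_def W(2), where Y = "Y \<omega>" and t = "- (\<sigma> * u)"] by simp
        then show ?thesis by linarith
      qed
    qed
    have "ennreal ((\<sigma> * u)\<^sup>2 * (1 / 12)) \<le> (\<integral>\<^sup>+\<omega>. ennreal ((median_filter n h (Y \<omega>) i - 0)\<^sup>2) \<partial>M)"
      by (rule M.nn_integral_square_ge[OF _ _ PA _ far]) (use \<sigma>_pos u in auto)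
    moreover have "(\<sigma> * u)\<^sup>2 * (1 / 12) = (\<sigma> * a)\<^sup>2 / 12 / m"
      using m by (simp add: u_def power_mult_distrib power_divide)
    ultimately show ?thesis unfolding Y_def W_def m_def by metis
  qed
  then show thesis using that[of "(\<sigma> * a)\<^sup>2 / 12"] \<sigma>_pos a by simp
qed

text \<open>The median can exceed \<open>1 / 2\<close> only if half of the window does, and a pixel with signal \<open>0\<close> does so
  with probability \<open>p < 1 / 2\<close>. If the pixels with signal \<open>1\<close> are a small enough fraction \<open>\<theta>\<close> of the
  window, the expected count stays a constant factor below what is needed, and Markov's
  inequality leaves a positive probability.\<close>

lemma median_bias_lower:
  obtains c \<theta> where "c > 0" "\<theta> > 0"
    "\<And>n h i f. i \<in> grid n \<Longrightarrow> 0 < h \<Longrightarrow> f (grid_point n i) = 1 \<Longrightarrow>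
      (\<And>j. j \<in> window n h i \<Longrightarrow> f (grid_point n j) = 0 \<or> f (grid_point n j) = 1) \<Longrightarrow>
      real (card {j \<in> window n h i. f (grid_point n j) = 1}) \<le> \<theta> * real (card (window n h i)) \<Longrightarrow>
      ennreal c \<le> (\<integral>\<^sup>+\<omega>. ennreal ((median_filter n h (observe n \<sigma> (Z n) f \<omega>) i - f (grid_point n i))\<^sup>2) \<partial>M)"
proof -
  define v where "v = 1 / (2 * \<sigma>)"
  define p where "p = prob {v<..}"
  have p: "0 \<le> p" "p < 1 / 2"
  proof -
    obtain c \<delta> where c: "c > 0" "\<delta> > 0" "\<And>t. 0 \<le> t \<Longrightarrow> t \<le> \<delta> \<Longrightarrow> prob {t<..} \<le> 1 / 2 - c * t"
      by (rule tail_linear) blast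
    have "p \<le> prob {min v \<delta><..}" unfolding p_def by (intro finite_measure_mono) auto
    also have "\<dots> \<le> 1 / 2 - c * min v \<delta>" using c \<sigma>_pos by (intro c) (auto simp: v_def)
    also have "\<dots> < 1 / 2" using c \<sigma>_pos by (simp add: v_def)
    finally show "p < 1 / 2" .
  qed (simp add: p_def)
  define \<theta> where "\<theta> = (1 / 2 - p) / 2"
  define r where "r = 1 - p / (1 / 2 - \<theta>)"
  have \<theta>: "0 < \<theta>" "0 < 1 / 2 - \<theta>" "p < 1 / 2 - \<theta>" using p by (auto simp: \<theta>_def field_simps)
  have r: "0 < r" using \<theta> by (simp add: r_def)
  have "ennreal ((1 / 2)\<^sup>2 * r) \<le> (\<integral>\<^sup>+\<omega>. ennreal ((median_filter n h (observe n \<sigma> (Z n) f \<omega>) i - f (grid_point n i))\<^sup>2) \<partial>M)"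
    if i: "i \<in> grid n" and h: "0 < h" and fi: "f (grid_point n i) = 1"
      and f01: "\<And>j. j \<in> window n h i \<Longrightarrow> f (grid_point n j) = 0 \<or> f (grid_point n j) = 1"
      and few: "real (card {j \<in> window n h i. f (grid_point n j) = 1}) \<le> \<theta> * real (card (window n h i))"
    for n h i f
  proof -
    define W m where "W = window n h i" and "m = real (card W)"
    define Y where "Y = observe n \<sigma> (Z n) f"
    have W: "W \<subseteq> grid n" "W \<noteq> {}" "finite W"
      using self_in_window[OF i, of h] h window_subset_grid by (auto simp: W_def)
    have m: "m > 0" using W by (simp add: m_def card_gt_0_iff)
    have Z_meas: "Z n j \<in> borel_measurable M" if "j \<in> W" for j using that W(1) noise_measurable by blast
    have Z_prob: "M.prob {\<omega> \<in> space M. Z n j \<omega> \<in> B} = prob B" if "j \<in> W" "B \<in> sets borel" for j B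
      using that W(1) noise_prob by blast
    define H where "H \<omega> = real (card {j \<in> W. Z n j \<omega> \<in> {v<..}})" for \<omega>
    have [measurable]: "H \<in> borel_measurable M"
      unfolding H_def by (intro borel_measurable_card_hits W Z_meas) auto
    let ?F = "{\<omega> \<in> space M. (1 / 2 - \<theta>) * m \<le> H \<omega>}"
    have "M.prob ?F \<le> real (card W) * p / ((1 / 2 - \<theta>) * m)"
      unfolding H_def p_def
      by (rule M.prob_many_hits_le[OF W(3) Z_meas _ Z_prob]) (use m \<theta> in auto)
    also have "\<dots> = p / (1 / 2 - \<theta>)" using m by (simp add: m_def)
    finally have "r \<le> M.prob (space M - ?F)" by (subst M.prob_compl) (auto simp: r_def)
    moreover have "1 / 2 \<le> \<bar>median_filter n h (Y \<omega>) i - f (grid_point n i)\<bar>" if \<omega>: "\<omega> \<in> space M - ?F" for \<omega>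
    proof -
      have "{j \<in> W. Y \<omega> j > 1 / 2} \<subseteq> {j \<in> W. f (grid_point n j) = 1} \<union> {j \<in> W. Z n j \<omega> \<in> {v<..}}"
      proof
        fix j assume j: "j \<in> {j \<in> W. Y \<omega> j > 1 / 2}"
        show "j \<in> {j \<in> W. f (grid_point n j) = 1} \<union> {j \<in> W. Z n j \<omega> \<in> {v<..}}"
        proof (cases "f (grid_point n j) = 1")
          case False
          then have "1 / 2 < \<sigma> * Z n j \<omega>" using j f01[of j] by (auto simp: W_def Y_def observe_def)
          then show ?thesis using j \<sigma>_pos by (simp add: v_def divide_less_eq mult_ac)
        qed (use j in auto)
      qed
      then have "card {j \<in> W. Y \<omega> j > 1 / 2}
          \<le> card ({j \<in> W. f (grid_point n j) = 1} \<union> {j \<in> W. Z n j \<omega> \<in> {v<..}})"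
        using W by (intro card_mono) auto
      also have "\<dots> \<le> card {j \<in> W. f (grid_point n j) = 1} + card {j \<in> W. Z n j \<omega> \<in> {v<..}}"
        by (rule card_Un_le)
      finally have "real (card {j \<in> W. Y \<omega> j > 1 / 2}) \<le> real (card {j \<in> W. f (grid_point n j) = 1}) + H \<omega>"
        by (simp add: H_def)
      moreover have "H \<omega> < (1 / 2 - \<theta>) * m" using \<omega> by auto
      ultimately have "real (card {j \<in> W. Y \<omega> j > 1 / 2}) < m / 2"
        using few by (simp add: W_def m_def algebra_simps)
      then have "2 * card {j \<in> W. Y \<omega> j > 1 / 2} < card W" by (simp add: m_def)
      then have "median_filter n h (Y \<omega>) i \<le> 1 / 2" by (rule median_le[OF W_def W(2)])
      then show ?thesis using fi by simp
    qed
    ultimately show ?thesis unfolding Y_def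
      by (intro M.nn_integral_square_ge[where A = "space M - ?F"]) (use r in auto)
  qed
  then show thesis using that[of "(1 / 2)\<^sup>2 * r" \<theta>] r \<theta> by simp
qed

end

section \<open>Lower bounds for small and for large bandwidths\<close>

definition corner_triangle :: "real \<Rightarrow> real \<Rightarrow> real \<times> real \<Rightarrow> real" where
  "corner_triangle w l x = (if fst x / w + snd x / l \<le> 1 then 1 else 0)"

text \<open>Within the square the indicator jumps only along the hypotenuse, one curve of length at most
  \<open>w + l\<close>; elsewhere it is locally constant.\<close>

lemma corner_triangle_in_CPLIP:
  assumes w: "0 < w" "w \<le> 1" and l: "0 < l" "l \<le> 1" and L: "w + l \<le> L" and "N \<ge> 1" "\<beta> > 0"
  shows "corner_triangle w l \<in> CPLIP L \<beta> N"
proof -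
  let ?g = "linepath (w, 0::real) (0, l)"
  have sub: "path_image ?g \<subseteq> unit_square"
    unfolding path_image_linepath
    by (intro closed_segment_subset convex_Times convex_real_interval)
       (use w l in \<open>auto simp: unit_square_def convex_Times\<close>)
  have "dist (w, 0::real) (0, l) \<le> L"
    using norm_Pair_le[of w "- l"] w l L by (simp add: dist_norm)
  then have "curve_length ?g \<le> ennreal L"
    using curve_length_linepath[of "(w, 0::real)" "(0, l)"] by (meson ennreal_leI order_trans)
  then have K: "{?g} \<in> complexes N L" using sub \<open>N \<ge> 1\<close> by (simp add: complexes_def rect_curves_def)
  define \<phi> where "\<phi> x = fst x / w + snd x / l" for x :: "real \<times> real"
  have cont: "continuous_on UNIV \<phi>" unfolding \<phi>_def by (intro continuous_intros) (use w l in auto)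
  have "local_Lip (corner_triangle w l) x \<le> ereal \<beta>"
    if x: "x \<in> unit_square" "x \<notin> path_image ?g" for x
  proof -
    have "\<phi> x \<noteq> 1"
    proof
      assume one: "\<phi> x = 1"
      have pos: "0 \<le> fst x / w" "0 \<le> snd x / l" using x(1) w l by (auto simp: unit_square_def)
      have "fst x / w = 1 - snd x / l" using one by (simp add: \<phi>_def)
      then have "x = (1 - snd x / l) *\<^sub>R (w, 0) + (snd x / l) *\<^sub>R (0, l)"
        using w l by (cases x) (simp add: divide_simps)
      moreover have "snd x / l \<le> 1" using one pos by (simp add: \<phi>_def)
      ultimately have "x \<in> path_image ?g" using pos unfolding path_image_linepath in_segment by blast
      then show False using x by simp
    qed
    define U where "U = (if \<phi> x < 1 then {y. \<phi> y < 1} else {y. \<phi> y > 1})"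
    have "open U"
      unfolding U_def using cont by (auto intro!: open_Collect_less continuous_intros)
    moreover have "x \<in> U" using \<open>\<phi> x \<noteq> 1\<close> by (auto simp: U_def)
    ultimately obtain d where d: "d > 0" "ball x d \<subseteq> U" by (meson open_contains_ball)
    show ?thesis
    proof (rule local_Lip_locally_constant[OF d(1)])
      fix y assume "norm (y - x) < d"
      then have "y \<in> U" using d(2) by (auto simp: dist_norm norm_minus_commute)
      then show "corner_triangle w l y = corner_triangle w l x"
        using \<open>x \<in> U\<close> by (auto simp: U_def corner_triangle_def \<phi>_def split: if_splits)
    qed (use \<open>\<beta> > 0\<close> in simp)
  qed
  moreover have "corner_triangle w l ` unit_square \<subseteq> {0..1}" by (auto simp: corner_triangle_def)
  ultimately show ?thesis unfolding CPLIP_def using K by blast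
qed

lemma nat_floor_half_le:
  fixes x :: real
  assumes "1 \<le> x"
  shows "x / 2 \<le> real (nat \<lfloor>x\<rfloor>)"
proof -
  from assms have "1 \<le> \<lfloor>x\<rfloor>" by (simp add: le_floor_iff)
  then show ?thesis by linarith
qed

context noisy_grid
begin

lemma class_risk_lower_small_bandwidth:
  obtains c where "c > 0"
    "\<And>n h. n > 0 \<Longrightarrow> 0 < h \<Longrightarrow> h < real n powr (- 2 / 3) \<Longrightarrow> \<beta> > 0 \<Longrightarrow>
      ennreal (c * real n powr (- 2 / 3)) \<le> class_risk M n \<sigma> (Z n) (median_filter n h) (CPLIP L \<beta> N)"
proof -
  obtain c where c: "c > 0" and low: "\<And>n h i. i \<in> grid n \<Longrightarrow> 0 < h \<Longrightarrow>
      ennreal (c / real (card (window n h i)))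
        \<le> (\<integral>\<^sup>+\<omega>. ennreal ((median_filter n h (observe n \<sigma> (Z n) (\<lambda>_. 0) \<omega>) i - 0)\<^sup>2) \<partial>M)"
    by (rule median_variance_lower) blast
  have "ennreal (c / 9 * real n powr (- 2 / 3)) \<le> class_risk M n \<sigma> (Z n) (median_filter n h) (CPLIP L \<beta> N)"
    if n: "n > 0" and h: "0 < h" "h < real n powr (- 2 / 3)" and \<beta>: "\<beta> > 0" for n h
  proof -
    have n1: "1 \<le> real n" using n by simp
    have "real n * h \<le> real n * real n powr (- 2 / 3)" using h by (intro mult_left_mono) auto
    also have "\<dots> = real n powr (1 / 3)" using powr_add[of "real n" 1 "- 2 / 3"] n by simp
    finally have nh: "real n * h \<le> real n powr (1 / 3)" .
    have one: "1 \<le> real n powr (1 / 3)" using n1 by (simp add: ge_one_powr_ge_zero)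
    have "(real n powr (1 / 3))\<^sup>2 = real n powr (2 / 3)" using n by (simp add: powr_powr flip: powr_numeral)
    then have sq: "(3 * real n powr (1 / 3))\<^sup>2 = 9 * real n powr (2 / 3)" by (simp add: power_mult_distrib)
    have "ennreal (real (card (grid n)) * (c / 9 * real n powr (- 2 / 3)) / (real n)\<^sup>2)
        \<le> risk M n \<sigma> (Z n) (median_filter n h) (\<lambda>_. 0)"
    proof (rule risk_ge)
      fix i assume i: "i \<in> grid n"
      have "0 < card (window n h i)" using self_in_window[OF i, of h] h by (auto simp: card_gt_0_iff)
      moreover have "real (card (window n h i)) \<le> 9 * real n powr (2 / 3)"
      proof -
        have "real (card (window n h i)) \<le> (2 * (real n * h) + 1)\<^sup>2" using h by (intro card_window_le) simp
        also have "\<dots> \<le> (3 * real n powr (1 / 3))\<^sup>2" using nh one h n by (intro power_mono) auto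
        finally show ?thesis unfolding sq .
      qed
      ultimately have "c / (9 * real n powr (2 / 3)) \<le> c / real (card (window n h i))"
        using c n by (intro divide_left_mono mult_pos_pos) auto
      moreover have "c / 9 * real n powr (- 2 / 3) = c / (9 * real n powr (2 / 3))"
        by (simp add: powr_minus_divide)
      ultimately have "ennreal (c / 9 * real n powr (- 2 / 3)) \<le> ennreal (c / real (card (window n h i)))"
        by (simp add: ennreal_leI)
      also have "\<dots> \<le> (\<integral>\<^sup>+\<omega>. ennreal ((median_filter n h (observe n \<sigma> (Z n) (\<lambda>_. 0) \<omega>) i - 0)\<^sup>2) \<partial>M)"
        by (rule low[OF i h(1)])
      finally show "ennreal (c / 9 * real n powr (- 2 / 3))
        \<le> (\<integral>\<^sup>+\<omega>. ennreal ((median_filter n h (observe n \<sigma> (Z n) (\<lambda>_. 0) \<omega>) i - 0)\<^sup>2) \<partial>M)" .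
    qed (use c in auto)
    also have "\<dots> \<le> class_risk M n \<sigma> (Z n) (median_filter n h) (CPLIP L \<beta> N)"
      unfolding class_risk_def by (intro SUP_upper zero_in_CPLIP \<beta>)
    finally show ?thesis using n by (simp add: card_grid power2_eq_square)
  qed
  then show thesis using that[of "c / 9"] c by simp
qed

text \<open>The width of the triangle is adapted to the bandwidth: a window around a pixel of the triangle holds at
  least \<open>(n h')\<^sup>2 / 4\<close> pixels, at most \<open>(n w) (3 n h') = 12 \<eta> (n h')\<^sup>2 / 4\<close> of which belong to the triangle. The
  truncation \<open>h' = min h 1\<close> takes care of bandwidths beyond the size of the image, where windows stop
  growing.\<close>

lemma class_risk_lower_large_bandwidth:
  assumes L: "L > 0" and \<beta>: "\<beta> > 0" and N: "N \<ge> 1"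
  obtains c where "c > 0"
    "\<forall>\<^sub>F n in sequentially. \<forall>h \<ge> real n powr (- 2 / 3).
      ennreal (c * real n powr (- 2 / 3)) \<le> class_risk M n \<sigma> (Z n) (median_filter n h) (CPLIP L \<beta> N)"
proof -
  obtain c \<theta> where c: "c > 0" and \<theta>: "\<theta> > 0" and low:
    "\<And>n h i f. i \<in> grid n \<Longrightarrow> 0 < h \<Longrightarrow> f (grid_point n i) = 1 \<Longrightarrow>
      (\<And>j. j \<in> window n h i \<Longrightarrow> f (grid_point n j) = 0 \<or> f (grid_point n j) = 1) \<Longrightarrow>
      real (card {j \<in> window n h i. f (grid_point n j) = 1}) \<le> \<theta> * real (card (window n h i)) \<Longrightarrow>
      ennreal c \<le> (\<integral>\<^sup>+\<omega>. ennreal ((median_filter n h (observe n \<sigma> (Z n) f \<omega>) i - f (grid_point n i))\<^sup>2) \<partial>M)"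
    by (rule median_bias_lower) blast
  define l where "l = min L 1 / 2"
  define \<eta> where "\<eta> = min l (\<theta> / 12)"
  have l: "0 < l" "l \<le> 1" "2 * l \<le> L" using L by (auto simp: l_def)
  have \<eta>: "0 < \<eta>" "\<eta> \<le> l" "12 * \<eta> \<le> \<theta>" using l \<theta> by (auto simp: \<eta>_def)
  define c' where "c' = \<eta> * l * c / 16"
  have c': "c' > 0" using \<eta> l c by (simp add: c'_def)
  have ev1: "\<forall>\<^sub>F n in sequentially. 2 / \<eta> \<le> real n powr (1 / 3)"
  proof -
    have "filterlim (\<lambda>n. real n powr (1 / 3)) at_top sequentially" by real_asymp
    then show ?thesis by (simp add: filterlim_at_top)
  qed
  have ev2: "\<forall>\<^sub>F n in sequentially. 2 / l \<le> real n"
    using filterlim_real_sequentially by (simp add: filterlim_at_top)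
  have "\<forall>\<^sub>F n in sequentially. \<forall>h \<ge> real n powr (- 2 / 3).
      ennreal (c' * real n powr (- 2 / 3)) \<le> class_risk M n \<sigma> (Z n) (median_filter n h) (CPLIP L \<beta> N)"
    using ev1 ev2 eventually_gt_at_top[of 0]
  proof eventually_elim
    case (elim n)
    have n: "n > 0" "1 \<le> real n" using elim by auto
    show ?case
    proof (intro allI impI)
      fix h :: real assume hn: "real n powr (- 2 / 3) \<le> h"
      define h' where "h' = min h 1"
      have "real n powr (- 2 / 3) \<le> 1" using n powr_mono[of "- 2 / 3" 0 "real n"] by simp
      then have h'n: "real n powr (- 2 / 3) \<le> h'" using hn by (simp add: h'_def)
      moreover have "0 < real n powr (- 2 / 3)" using n by simp
      ultimately have h': "0 < h'" "h' \<le> 1" "h' \<le> h" and h: "0 < h"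
        unfolding h'_def by linarith+
      have "real n powr (1 / 3) = real n * real n powr (- 2 / 3)"
        using powr_add[of "real n" 1 "- 2 / 3"] n by simp
      also have "\<dots> \<le> real n * h'" using h'n by (intro mult_left_mono) auto
      finally have nh': "real n powr (1 / 3) \<le> real n * h'" .
      have nh1: "1 \<le> real n * h'" using nh' n by (smt (verit) ge_one_powr_ge_zero divide_nonneg_nonneg)
      define w where "w = \<eta> * h'"
      have w: "0 < w" "w \<le> \<eta>" using \<eta> h' by (auto simp: w_def mult_left_le)
      have nw: "2 \<le> real n * w"
      proof -
        have "2 \<le> \<eta> * real n powr (1 / 3)" using elim(1) \<eta> by (simp add: divide_le_eq mult.commute)
        also have "\<dots> \<le> \<eta> * (real n * h')" using nh' \<eta> by simp
        finally show ?thesis by (simp add: w_def mult_ac)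
      qed
      have nl: "2 \<le> real n * l" using elim(2) l by (simp add: divide_le_eq)
      define f where "f = corner_triangle w l"
      have f: "f \<in> CPLIP L \<beta> N" unfolding f_def
        by (rule corner_triangle_in_CPLIP) (use w l \<eta> N \<beta> in auto)
      \<comment> \<open>The rectangle with corners at \<open>0\<close> and \<open>(w / 2, l / 2)\<close> lies in the triangle.\<close>
      define P where "P = {1..nat \<lfloor>real n * w / 2\<rfloor>} \<times> {1..nat \<lfloor>real n * l / 2\<rfloor>}"
      have P_mem: "fst i \<ge> 1" "snd i \<ge> 1" "real (fst i) \<le> real n * w / 2" "real (snd i) \<le> real n * l / 2"
        if "i \<in> P" for i
      proof -
        have i: "1 \<le> fst i" "fst i \<le> nat \<lfloor>real n * w / 2\<rfloor>" "1 \<le> snd i" "snd i \<le> nat \<lfloor>real n * l / 2\<rfloor>"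
          using that by (auto simp: P_def)
        show "fst i \<ge> 1" "snd i \<ge> 1" by fact+
        show "real (fst i) \<le> real n * w / 2" "real (snd i) \<le> real n * l / 2" using i by linarith+
      qed
      have P: "P \<subseteq> grid n"
      proof
        fix i assume i: "i \<in> P"
        have "real n * w \<le> real n * 1" "real n * l \<le> real n * 1" using w \<eta> l by (intro mult_left_mono; simp)+
        then have "real (fst i) \<le> real n" "real (snd i) \<le> real n" using P_mem[OF i] n by linarith+
        then show "i \<in> grid n" using P_mem[OF i] by (cases i) (auto simp: grid_def)
      qed
      have cardP: "(real n)\<^sup>2 * (w * l) / 16 \<le> real (card P)"
      proof -
        have "(real n * w / 2 / 2) * (real n * l / 2 / 2)
            \<le> real (nat \<lfloor>real n * w / 2\<rfloor>) * real (nat \<lfloor>real n * l / 2\<rfloor>)"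
          using nw nl w l by (intro mult_mono nat_floor_half_le) auto
        then show ?thesis by (simp add: P_def card_cartesian_product power2_eq_square mult_ac)
      qed
      have ones: "real (fst j) \<le> real n * w" if j: "f (grid_point n j) = 1" for j
      proof -
        have "real (fst j) / real n / w + real (snd j) / real n / l \<le> 1"
          using j by (simp add: f_def corner_triangle_def grid_point_def split: if_splits)
        moreover have "0 \<le> real (snd j) / real n / l" using l by simp
        ultimately have "real (fst j) / real n / w \<le> 1" by linarith
        then show ?thesis using w n by (simp add: divide_le_eq mult.commute)
      qed
      have pixel: "ennreal c \<le> (\<integral>\<^sup>+\<omega>. ennreal ((median_filter n h (observe n \<sigma> (Z n) f \<omega>) i - f (grid_point n i))\<^sup>2) \<partial>M)"
        if i: "i \<in> P" for i
      proof (rule low)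
        show ig: "i \<in> grid n" using i P by blast
        have "real (fst i) / real n / w \<le> 1 / 2" "real (snd i) / real n / l \<le> 1 / 2"
          using P_mem[OF i] n w l by (simp_all add: divide_le_eq mult_ac)
        then have "real (fst i) / real n / w + real (snd i) / real n / l \<le> 1" by linarith
        then show "f (grid_point n i) = 1" by (simp add: f_def corner_triangle_def grid_point_def)
        show "0 < h" by (rule h)
        show "f (grid_point n j) = 0 \<or> f (grid_point n j) = 1" for j
          by (simp add: f_def corner_triangle_def)
        let ?J = "{k. \<bar>real k - real (snd i)\<bar> \<le> real n * h'}"
        have "{j \<in> window n h i. f (grid_point n j) = 1} \<subseteq> {1..nat \<lfloor>real n * w\<rfloor>} \<times> ?J"
        proof
          fix j assume j: "j \<in> {j \<in> window n h i. f (grid_point n j) = 1}"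
          then have "j \<in> window n h i" by simp
          then have jg: "j \<in> grid n" and "\<bar>real (snd j) - real (snd i)\<bar> \<le> real n * h"
            using window_subset_grid[of n h i] window_subset_product[of n h i] by auto
          moreover have "\<bar>real (snd j) - real (snd i)\<bar> \<le> real n * 1"
            using jg ig by (auto simp: grid_def abs_le_iff)
          ultimately have "snd j \<in> ?J" by (simp add: h'_def min_def)
          moreover have "fst j \<in> {1..nat \<lfloor>real n * w\<rfloor>}"
            using ones[of j] j jg by (auto simp: grid_def le_nat_iff le_floor_iff)
          ultimately show "j \<in> {1..nat \<lfloor>real n * w\<rfloor>} \<times> ?J" by (cases j) auto
        qed
        then have "card {j \<in> window n h i. f (grid_point n j) = 1} \<le> card ({1..nat \<lfloor>real n * w\<rfloor>} \<times> ?J)"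
          by (intro card_mono) (use card_nat_near(1) nh1 in auto)
        then have "real (card {j \<in> window n h i. f (grid_point n j) = 1})
            \<le> real (nat \<lfloor>real n * w\<rfloor>) * real (card ?J)"
          by (simp add: card_cartesian_product flip: of_nat_mult)
        also have "\<dots> \<le> (real n * w) * (2 * (real n * h') + 1)"
          by (intro mult_mono card_nat_near(2)) (use nw nh1 in linarith)+
        also have "\<dots> \<le> (real n * w) * (3 * (real n * h'))"
          by (intro mult_left_mono) (use nw nh1 in linarith)+
        also have "\<dots> = 12 * \<eta> * ((real n * h')\<^sup>2 / 4)" by (simp add: w_def power2_eq_square)
        also have "\<dots> \<le> \<theta> * ((real n * h')\<^sup>2 / 4)" using \<eta> by (intro mult_right_mono) auto
        also have "\<dots> \<le> \<theta> * real (card (window n h i))"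
        proof (intro mult_left_mono)
          have "(real n * h')\<^sup>2 / 4 \<le> real (card (window n h' i))" by (rule card_window_ge[OF ig]) (use h' in auto)
          also have "\<dots> \<le> real (card (window n h i))" using window_mono[OF h'(3), of n i] by (simp add: card_mono)
          finally show "(real n * h')\<^sup>2 / 4 \<le> real (card (window n h i))" .
        qed (use \<theta> in simp)
        finally show "real (card {j \<in> window n h i. f (grid_point n j) = 1}) \<le> \<theta> * real (card (window n h i))" .
      qed
      have "c' * real n powr (- 2 / 3) \<le> c' * h'" using c' h'n by simp
      also have "\<dots> = ((real n)\<^sup>2 * (w * l) / 16) * c / (real n)\<^sup>2" using n by (simp add: c'_def w_def)
      also have "\<dots> \<le> real (card P) * c / (real n)\<^sup>2"
        by (intro divide_right_mono mult_right_mono cardP) (use c in auto)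
      finally have "ennreal (c' * real n powr (- 2 / 3)) \<le> ennreal (real (card P) * c / (real n)\<^sup>2)"
        by (rule ennreal_leI)
      also have "\<dots> \<le> risk M n \<sigma> (Z n) (median_filter n h) f"
        by (rule risk_ge[OF P _ pixel]) (use c in auto)
      also have "\<dots> \<le> class_risk M n \<sigma> (Z n) (median_filter n h) (CPLIP L \<beta> N)"
        unfolding class_risk_def by (rule SUP_upper[OF f])
      finally show "ennreal (c' * real n powr (- 2 / 3))
          \<le> class_risk M n \<sigma> (Z n) (median_filter n h) (CPLIP L \<beta> N)" .
    qed
  qed
  then show thesis using that c' by blast
qed

end

section \<open>The rate\<close>

lemma same_order_of_bounds:
  assumes "0 < c" and low: "\<forall>\<^sub>F n in sequentially. ennreal (c * b n) \<le> a n"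
    and up: "\<forall>\<^sub>F n in sequentially. a n \<le> ennreal (C * b n)" and b: "\<forall>\<^sub>F n in sequentially. 0 < b n"
  shows "same_order a (\<lambda>n. ennreal (b n))"
  unfolding same_order_def
proof (intro exI conjI)
  have quot: "ennreal (x * y) / ennreal y = ennreal x" if "0 < y" "0 \<le> x" for x y
    using that by (simp add: divide_ennreal)
  show "\<forall>\<^sub>F n in sequentially. ennreal c \<le> a n / ennreal (b n) \<and> a n / ennreal (b n) \<le> ennreal (max 0 C)"
    using low up b
  proof eventually_elim
    case (elim n)
    have "a n \<le> ennreal (max 0 C * b n)"
      using elim by (meson ennreal_leI less_imp_le max.cobounded2 mult_right_mono order_trans)
    then show ?case
      using divide_right_mono_ennreal[OF elim(1), of "ennreal (b n)"]
        divide_right_mono_ennreal[of "a n" "ennreal (max 0 C * b n)" "ennreal (b n)"]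
        quot[OF elim(3), of c] quot[OF elim(3), of "max 0 C"] \<open>0 < c\<close> by simp
  qed
qed fact

theorem theorem3p2:
  fixes \<sigma> L \<beta> :: real and N :: nat
    and \<Psi> :: "real measure" and \<psi> :: "real \<Rightarrow> real"
    and M :: "'a measure" and Z :: "nat \<Rightarrow> nat \<times> nat \<Rightarrow> 'a \<Rightarrow> real"
  assumes "\<sigma> > 0" and "L > 0" and "N \<ge> 1" and "\<beta> > 0"
    and "shape_cond \<Psi> \<psi>"
    and "decay_exponent \<psi> > 1"
    and "prob_space M"
    and "\<And>n. white_noise M \<Psi> n (Z n)"
  shows "same_order
           (\<lambda>n. INF h \<in> {0<..}. class_risk M n \<sigma> (Z n) (median_filter n h) (CPLIP L \<beta> N))
           (\<lambda>n. ennreal (real n powr (- 2 / 3)))"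
proof -
  interpret M: prob_space M by fact
  have "(1, 1) \<in> grid 1" by (simp add: grid_def)
  then have "Z 1 (1, 1) \<in> borel_measurable M" "distr M borel (Z 1 (1, 1)) = \<Psi>"
    using assms(8)[of 1] by (auto simp: white_noise_def M.indep_vars_def)
  then have "prob_space \<Psi>" using M.prob_space_distr by blast
  then interpret noisy_grid \<Psi> \<psi> M Z \<sigma>
    by (intro noisy_grid.intro noise_law.intro noisy_grid_axioms.intro) (use assms in auto)
  let ?R = "\<lambda>n h. class_risk M n \<sigma> (Z n) (median_filter n h) (CPLIP L \<beta> N)"
  let ?rate = "\<lambda>n. real n powr (- 2 / 3)"
  obtain C where C: "\<forall>\<^sub>F n in sequentially. ?R n (?rate n) \<le> ennreal (C * ?rate n)"
    using class_risk_upper[OF \<open>L > 0\<close> \<open>\<beta> > 0\<close>] by blast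
  obtain c\<^sub>1 where c1: "c\<^sub>1 > 0" "\<And>n h. n > 0 \<Longrightarrow> 0 < h \<Longrightarrow> h < ?rate n \<Longrightarrow> ennreal (c\<^sub>1 * ?rate n) \<le> ?R n h"
    using class_risk_lower_small_bandwidth \<open>\<beta> > 0\<close> by metis
  obtain c\<^sub>2 where c2: "c\<^sub>2 > 0" "\<forall>\<^sub>F n in sequentially. \<forall>h \<ge> ?rate n. ennreal (c\<^sub>2 * ?rate n) \<le> ?R n h"
    using class_risk_lower_large_bandwidth[OF \<open>L > 0\<close> \<open>\<beta> > 0\<close> \<open>N \<ge> 1\<close>] by blast
  have pos: "\<forall>\<^sub>F n in sequentially. 0 < ?rate n"
    using eventually_gt_at_top[of 0] by eventually_elim simp
  show ?thesis
  proof (rule same_order_of_bounds)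
    show "0 < min c\<^sub>1 c\<^sub>2" using c1 c2 by simp
    show "\<forall>\<^sub>F n in sequentially. ennreal (min c\<^sub>1 c\<^sub>2 * ?rate n) \<le> (INF h \<in> {0<..}. ?R n h)"
      using c2(2) eventually_gt_at_top[of 0]
    proof eventually_elim
      case (elim n)
      show ?case
      proof (rule INF_greatest)
        fix h :: real assume h: "h \<in> {0<..}"
        have "ennreal (min c\<^sub>1 c\<^sub>2 * ?rate n) \<le> ennreal (c\<^sub>1 * ?rate n)"
             "ennreal (min c\<^sub>1 c\<^sub>2 * ?rate n) \<le> ennreal (c\<^sub>2 * ?rate n)"
          by (intro ennreal_leI mult_right_mono; simp)+
        then show "ennreal (min c\<^sub>1 c\<^sub>2 * ?rate n) \<le> ?R n h"
          using c1(2)[of n h] elim h by (cases "h < ?rate n") (auto intro: order_trans)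
      qed
    qed
    show "\<forall>\<^sub>F n in sequentially. (INF h \<in> {0<..}. ?R n h) \<le> ennreal (C * ?rate n)"
      using C pos by eventually_elim (rule INF_lower2, auto)
  qed (rule pos)
qed

end
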